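(* Let $\mathcal{A}$ be an abelian length category. (1) Every ICE-closed subcategory of $\mathcal{A}$ can be realized as the heart of some interval in $\mathsf{tors}\,\mathcal{A}$. (2) Let $[\mathcal{U},\mathcal{T}]$ be an interval in $\mathsf{tors}\,\mathcal{A}$. Then the following are equivalent. (a) $[\mathcal{U},\mathcal{T}]$ is an ICE interval, that is, its heart is an ICE-closed subcategory of $\mathcal{A}$. (b) There is some $\mathcal{T}'\in\mathsf{tors}\,\mathcal{A}$ with $\mathcal{U}\subseteq\mathcal{T}\subseteq\mathcal{T}'$ such that $[\mathcal{U},\mathcal{T}']$ is a wide interval. (c) $\mathcal{T}\subseteq\mathcal{U}^+$ holds, where $\mathcal{U}^+ := \mathcal{U}\vee\bigvee\{\mathcal{U}'\in\mathsf{tors}\,\mathcal{A} \mid \text{there is an arrow } \mathcal{U}'\to\mathcal{U} \text{ in the Hasse quiver of } \mathsf{tors}\,\mathcal{A}\}$.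
   Context: All categories are skeletally small. An abelian length category is an abelian category in which every object has finite length. All subcategories are full, closed under isomorphisms, and contain the zero object. A torsion class in $\mathcal{A}$ is a subcategory closed under extensions and quotients. $\mathsf{tors}\,\mathcal{A}$ is the set of torsion classes in $\mathcal{A}$ ordered by inclusion; it is a complete lattice (meets are intersections), with join denoted $\vee$. For $\mathcal{U}\subseteq\mathcal{T}$ in $\mathsf{tors}\,\mathcal{A}$, $[\mathcal{U},\mathcal{T}]$ denotes the interval $\{\mathcal{S}\in\mathsf{tors}\,\mathcal{A}\mid \mathcal{U}\subseteq\mathcal{S}\subseteq\mathcal{T}\}$, and its heart is the subcategory $\mathcal{H}_{[\mathcal{U},\mathcal{T}]}:=\mathcal{T}\cap\mathcal{U}^{\perp}$, where $\mathcal{U}^\perp=\{M\in\mathcal{A}\mid \mathrm{Hom}_{\mathcal{A}}(U,M)=0 \text{ for all } U\in\mathcal{U}\}$. A subcategory $\mathcal{C}$ of $\mathcal{A}$ is wide if it is closed under extensions, and under kernels and cokernels (in $\mathcal{A}$) of morphisms between objects of $\mathcal{C}$; it is ICE-closed if it is closed under extensions, and under images and cokernels (in $\mathcal{A}$) of morphisms between objects of $\mathcal{C}$. An interval is a wide interval if its heart is a wide subcategory of $\mathcal{A}$. The Hasse quiver of a poset $P$ has vertex set $P$ and an arrow $p\to q$ whenever $p>q$ and there is no $r\in P$ with $p>r>q$. *)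

theory Defs
  imports "HOL-Algebra.Group"
begin

section \<open>Categories\<close>

text \<open>
  \<open>g \<cdot> f\<close> is \<open>g\<close> after \<open>f\<close>. All operations are only constrained on objects in
  \<open>Obj A\<close> and (composable or parallel) arrows in \<open>Arr A\<close>.
\<close>

record ('o, 'm) category =
  Obj :: "'o set"
  Arr :: "'m set"
  Dom :: "'m \<Rightarrow> 'o"
  Cod :: "'m \<Rightarrow> 'o"
  Ide :: "'o \<Rightarrow> 'm"
  Comp :: "'m \<Rightarrow> 'm \<Rightarrow> 'm" (infixl \<open>\<cdot>\<index>\<close> 70)

definition Hom :: "('o, 'm, 'x) category_scheme \<Rightarrow> 'o \<Rightarrow> 'o \<Rightarrow> 'm set" where
  "Hom A X Y = {f \<in> Arr A. Dom A f = X \<and> Cod A f = Y}"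

locale category =
  fixes A :: "('o, 'm, 'x) category_scheme" (structure)
  assumes Dom_closed: "f \<in> Arr A \<Longrightarrow> Dom A f \<in> Obj A"
    and Cod_closed: "f \<in> Arr A \<Longrightarrow> Cod A f \<in> Obj A"
    and Ide_in_Hom: "X \<in> Obj A \<Longrightarrow> Ide A X \<in> Hom A X X"
    and Comp_in_Hom: "\<lbrakk>f \<in> Hom A X Y; g \<in> Hom A Y Z\<rbrakk> \<Longrightarrow> g \<cdot> f \<in> Hom A X Z"
    and Comp_Ide_right: "f \<in> Hom A X Y \<Longrightarrow> f \<cdot> Ide A X = f"
    and Comp_Ide_left: "f \<in> Hom A X Y \<Longrightarrow> Ide A Y \<cdot> f = f"
    and Comp_assoc: "\<lbrakk>f \<in> Hom A W X; g \<in> Hom A X Y; h \<in> Hom A Y Z\<rbrakk>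
      \<Longrightarrow> (h \<cdot> g) \<cdot> f = h \<cdot> (g \<cdot> f)"

definition monic :: "('o, 'm, 'x) category_scheme \<Rightarrow> 'm \<Rightarrow> bool" where
  "monic A f \<longleftrightarrow> f \<in> Arr A \<and>
    (\<forall>W. \<forall>g\<in>Hom A W (Dom A f). \<forall>h\<in>Hom A W (Dom A f). f \<cdot>\<^bsub>A\<^esub> g = f \<cdot>\<^bsub>A\<^esub> h \<longrightarrow> g = h)"

definition epic :: "('o, 'm, 'x) category_scheme \<Rightarrow> 'm \<Rightarrow> bool" where
  "epic A f \<longleftrightarrow> f \<in> Arr A \<and>
    (\<forall>W. \<forall>g\<in>Hom A (Cod A f) W. \<forall>h\<in>Hom A (Cod A f) W. g \<cdot>\<^bsub>A\<^esub> f = h \<cdot>\<^bsub>A\<^esub> f \<longrightarrow> g = h)"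

definition iso_arrow :: "('o, 'm, 'x) category_scheme \<Rightarrow> 'm \<Rightarrow> bool" where
  "iso_arrow A f \<longleftrightarrow> f \<in> Arr A \<and>
    (\<exists>g\<in>Hom A (Cod A f) (Dom A f). g \<cdot>\<^bsub>A\<^esub> f = Ide A (Dom A f) \<and> f \<cdot>\<^bsub>A\<^esub> g = Ide A (Cod A f))"

definition isomorphic :: "('o, 'm, 'x) category_scheme \<Rightarrow> 'o \<Rightarrow> 'o \<Rightarrow> bool" where
  "isomorphic A X Y \<longleftrightarrow> (\<exists>f\<in>Hom A X Y. iso_arrow A f)"

definition zero_object :: "('o, 'm, 'x) category_scheme \<Rightarrow> 'o \<Rightarrow> bool" where
  "zero_object A Z \<longleftrightarrow> Z \<in> Obj A \<and>
    (\<forall>X\<in>Obj A. (\<exists>!f. f \<in> Hom A X Z) \<and> (\<exists>!f. f \<in> Hom A Z X))"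


section \<open>Abelian length categories\<close>

record ('o, 'm) preadditive_category = "('o, 'm) category" +
  Plus :: "'m \<Rightarrow> 'm \<Rightarrow> 'm" (infixl \<open>\<oplus>\<^sub>h\<index>\<close> 65)
  Zero :: "'o \<Rightarrow> 'o \<Rightarrow> 'm"

definition Hom_group :: "('o, 'm, 'x) preadditive_category_scheme \<Rightarrow> 'o \<Rightarrow> 'o \<Rightarrow> 'm monoid" where
  "Hom_group A X Y = \<lparr>carrier = Hom A X Y, mult = Plus A, one = Zero A X Y\<rparr>"

locale preadditive_category = category A
  for A :: "('o, 'm, 'x) preadditive_category_scheme" (structure) +
  assumes Hom_comm_group: "\<lbrakk>X \<in> Obj A; Y \<in> Obj A\<rbrakk> \<Longrightarrow> comm_group (Hom_group A X Y)"
    and Comp_Plus_right: "\<lbrakk>f \<in> Hom A X Y; f' \<in> Hom A X Y; g \<in> Hom A Y Z\<rbrakk>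
      \<Longrightarrow> g \<cdot> (f \<oplus>\<^sub>h f') = (g \<cdot> f) \<oplus>\<^sub>h (g \<cdot> f')"
    and Comp_Plus_left: "\<lbrakk>f \<in> Hom A X Y; g \<in> Hom A Y Z; g' \<in> Hom A Y Z\<rbrakk>
      \<Longrightarrow> (g \<oplus>\<^sub>h g') \<cdot> f = (g \<cdot> f) \<oplus>\<^sub>h (g' \<cdot> f)"

definition biproduct ::
  "('o, 'm, 'x) preadditive_category_scheme \<Rightarrow> 'o \<Rightarrow> 'o \<Rightarrow> 'o \<Rightarrow> 'm \<Rightarrow> 'm \<Rightarrow> 'm \<Rightarrow> 'm \<Rightarrow> bool" where
  "biproduct A X Y B i j p q \<longleftrightarrow>
    B \<in> Obj A \<and> i \<in> Hom A X B \<and> j \<in> Hom A Y B \<and> p \<in> Hom A B X \<and> q \<in> Hom A B Y \<and>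
    p \<cdot>\<^bsub>A\<^esub> i = Ide A X \<and> q \<cdot>\<^bsub>A\<^esub> j = Ide A Y \<and>
    p \<cdot>\<^bsub>A\<^esub> j = Zero A Y X \<and> q \<cdot>\<^bsub>A\<^esub> i = Zero A X Y \<and>
    (i \<cdot>\<^bsub>A\<^esub> p) \<oplus>\<^sub>h\<^bsub>A\<^esub> (j \<cdot>\<^bsub>A\<^esub> q) = Ide A B"

text \<open>\<open>is_kernel A f k\<close>: the arrow \<open>k\<close> is a kernel of \<open>f\<close>; the kernel object is \<open>Dom A k\<close>.\<close>

definition is_kernel :: "('o, 'm, 'x) preadditive_category_scheme \<Rightarrow> 'm \<Rightarrow> 'm \<Rightarrow> bool" where
  "is_kernel A f k \<longleftrightarrow> f \<in> Arr A \<and> k \<in> Arr A \<and> Cod A k = Dom A f \<and>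
    f \<cdot>\<^bsub>A\<^esub> k = Zero A (Dom A k) (Cod A f) \<and>
    (\<forall>W. \<forall>h\<in>Hom A W (Dom A f). f \<cdot>\<^bsub>A\<^esub> h = Zero A W (Cod A f) \<longrightarrow>
      (\<exists>!u. u \<in> Hom A W (Dom A k) \<and> k \<cdot>\<^bsub>A\<^esub> u = h))"

definition is_cokernel :: "('o, 'm, 'x) preadditive_category_scheme \<Rightarrow> 'm \<Rightarrow> 'm \<Rightarrow> bool" where
  "is_cokernel A f c \<longleftrightarrow> f \<in> Arr A \<and> c \<in> Arr A \<and> Dom A c = Cod A f \<and>
    c \<cdot>\<^bsub>A\<^esub> f = Zero A (Dom A f) (Cod A c) \<and>
    (\<forall>W. \<forall>h\<in>Hom A (Cod A f) W. h \<cdot>\<^bsub>A\<^esub> f = Zero A (Dom A f) W \<longrightarrow>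
      (\<exists>!u. u \<in> Hom A (Cod A c) W \<and> u \<cdot>\<^bsub>A\<^esub> c = h))"

text \<open>The image is the kernel of the cokernel; the image object is \<open>Dom A m\<close>.\<close>

definition is_image :: "('o, 'm, 'x) preadditive_category_scheme \<Rightarrow> 'm \<Rightarrow> 'm \<Rightarrow> bool" where
  "is_image A f m \<longleftrightarrow> (\<exists>c. is_cokernel A f c \<and> is_kernel A c m)"

definition short_exact :: "('o, 'm, 'x) preadditive_category_scheme \<Rightarrow> 'm \<Rightarrow> 'm \<Rightarrow> bool" where
  "short_exact A f g \<longleftrightarrow> is_kernel A g f \<and> is_cokernel A f g"

locale abelian_category = preadditive_category A
  for A :: "('o, 'm, 'x) preadditive_category_scheme" (structure) +
  assumes zero_object_exists: "\<exists>Z. zero_object A Z"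
    and biproduct_exists: "\<lbrakk>X \<in> Obj A; Y \<in> Obj A\<rbrakk> \<Longrightarrow> \<exists>B i j p q. biproduct A X Y B i j p q"
    and kernel_exists: "f \<in> Arr A \<Longrightarrow> \<exists>k. is_kernel A f k"
    and cokernel_exists: "f \<in> Arr A \<Longrightarrow> \<exists>c. is_cokernel A f c"
    and monic_is_kernel: "monic A f \<Longrightarrow> \<exists>g. is_kernel A g f"
    and epic_is_cokernel: "epic A f \<Longrightarrow> \<exists>g. is_cokernel A g f"

definition simple_object :: "('o, 'm, 'x) preadditive_category_scheme \<Rightarrow> 'o \<Rightarrow> bool" where
  "simple_object A S \<longleftrightarrow> S \<in> Obj A \<and> \<not> zero_object A S \<and>
    (\<forall>m. monic A m \<and> Cod A m = S \<longrightarrow> zero_object A (Dom A m) \<or> iso_arrow A m)"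

text \<open>
  Finite length means having a composition series, given here as a chain of monomorphisms
  \<open>0 = Y 0 \<rightarrow> Y 1 \<rightarrow> \<dots> \<rightarrow> Y n = X\<close> with simple cokernels (the corresponding
  subobjects of \<open>X\<close> are the composites \<open>Y i \<rightarrow> X\<close>).
\<close>

definition finite_length :: "('o, 'm, 'x) preadditive_category_scheme \<Rightarrow> 'o \<Rightarrow> bool" where
  "finite_length A X \<longleftrightarrow> (\<exists>(n::nat) Y u. zero_object A (Y 0) \<and> Y n = X \<and>
    (\<forall>i<n. u i \<in> Hom A (Y i) (Y (Suc i)) \<and> monic A (u i) \<and>
      (\<exists>c. is_cokernel A (u i) c \<and> simple_object A (Cod A c))))"

locale abelian_length_category = abelian_category A
  for A :: "('o, 'm, 'x) preadditive_category_scheme" (structure) +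
  assumes finite_length: "X \<in> Obj A \<Longrightarrow> finite_length A X"


section \<open>Subcategories\<close>

text \<open>
  All subcategories are full, closed under isomorphisms and contain the zero object, so they are
  represented by their sets of objects.
\<close>

definition subcategory :: "('o, 'm, 'x) category_scheme \<Rightarrow> 'o set \<Rightarrow> bool" where
  "subcategory A C \<longleftrightarrow> C \<subseteq> Obj A \<and> (\<exists>Z\<in>C. zero_object A Z) \<and>
    (\<forall>X\<in>C. \<forall>Y. isomorphic A X Y \<longrightarrow> Y \<in> C)"

definition extension_closed :: "('o, 'm, 'x) preadditive_category_scheme \<Rightarrow> 'o set \<Rightarrow> bool" where
  "extension_closed A C \<longleftrightarrow>
    (\<forall>f g. short_exact A f g \<and> Dom A f \<in> C \<and> Cod A g \<in> C \<longrightarrow> Cod A f \<in> C)"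

definition quotient_closed :: "('o, 'm, 'x) category_scheme \<Rightarrow> 'o set \<Rightarrow> bool" where
  "quotient_closed A C \<longleftrightarrow> (\<forall>f. epic A f \<and> Dom A f \<in> C \<longrightarrow> Cod A f \<in> C)"

definition kernel_closed :: "('o, 'm, 'x) preadditive_category_scheme \<Rightarrow> 'o set \<Rightarrow> bool" where
  "kernel_closed A C \<longleftrightarrow>
    (\<forall>f k. Dom A f \<in> C \<and> Cod A f \<in> C \<and> is_kernel A f k \<longrightarrow> Dom A k \<in> C)"

definition cokernel_closed :: "('o, 'm, 'x) preadditive_category_scheme \<Rightarrow> 'o set \<Rightarrow> bool" where
  "cokernel_closed A C \<longleftrightarrow>
    (\<forall>f c. Dom A f \<in> C \<and> Cod A f \<in> C \<and> is_cokernel A f c \<longrightarrow> Cod A c \<in> C)"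

definition image_closed :: "('o, 'm, 'x) preadditive_category_scheme \<Rightarrow> 'o set \<Rightarrow> bool" where
  "image_closed A C \<longleftrightarrow>
    (\<forall>f m. Dom A f \<in> C \<and> Cod A f \<in> C \<and> is_image A f m \<longrightarrow> Dom A m \<in> C)"

definition wide :: "('o, 'm, 'x) preadditive_category_scheme \<Rightarrow> 'o set \<Rightarrow> bool" where
  "wide A C \<longleftrightarrow> subcategory A C \<and> extension_closed A C \<and> kernel_closed A C \<and> cokernel_closed A C"

definition ICE_closed :: "('o, 'm, 'x) preadditive_category_scheme \<Rightarrow> 'o set \<Rightarrow> bool" where
  "ICE_closed A C \<longleftrightarrow> subcategory A C \<and> extension_closed A C \<and> image_closed A C \<and> cokernel_closed A C"

definition torsion_class :: "('o, 'm, 'x) preadditive_category_scheme \<Rightarrow> 'o set \<Rightarrow> bool" where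
  "torsion_class A T \<longleftrightarrow> subcategory A T \<and> extension_closed A T \<and> quotient_closed A T"


section \<open>The poset of torsion classes\<close>

definition tors :: "('o, 'm, 'x) preadditive_category_scheme \<Rightarrow> 'o set gorder" where
  "tors A = \<lparr>carrier = {T. torsion_class A T}, eq = (=), le = (\<subseteq>)\<rparr>"

definition Hasse_arrow :: "('a, 'b) gorder_scheme \<Rightarrow> 'a \<Rightarrow> 'a \<Rightarrow> bool" where
  "Hasse_arrow P p q \<longleftrightarrow> p \<in> carrier P \<and> q \<in> carrier P \<and> q \<sqsubset>\<^bsub>P\<^esub> p \<and>
    \<not> (\<exists>r\<in>carrier P. q \<sqsubset>\<^bsub>P\<^esub> r \<and> r \<sqsubset>\<^bsub>P\<^esub> p)"

definition right_perp :: "('o, 'm, 'x) preadditive_category_scheme \<Rightarrow> 'o set \<Rightarrow> 'o set" where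
  "right_perp A U = {M \<in> Obj A. \<forall>X\<in>U. Hom A X M = {Zero A X M}}"

text \<open>An interval \<open>[U, T]\<close> is represented by its end points.\<close>

definition tors_interval :: "('o, 'm, 'x) preadditive_category_scheme \<Rightarrow> 'o set \<Rightarrow> 'o set \<Rightarrow> bool" where
  "tors_interval A U T \<longleftrightarrow> U \<in> carrier (tors A) \<and> T \<in> carrier (tors A) \<and> U \<subseteq> T"

definition heart :: "('o, 'm, 'x) preadditive_category_scheme \<Rightarrow> 'o set \<Rightarrow> 'o set \<Rightarrow> 'o set" where
  "heart A U T = T \<inter> right_perp A U"

definition wide_interval :: "('o, 'm, 'x) preadditive_category_scheme \<Rightarrow> 'o set \<Rightarrow> 'o set \<Rightarrow> bool" where
  "wide_interval A U T \<longleftrightarrow> tors_interval A U T \<and> wide A (heart A U T)"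

definition ICE_interval :: "('o, 'm, 'x) preadditive_category_scheme \<Rightarrow> 'o set \<Rightarrow> 'o set \<Rightarrow> bool" where
  "ICE_interval A U T \<longleftrightarrow> tors_interval A U T \<and> ICE_closed A (heart A U T)"

definition tors_plus :: "('o, 'm, 'x) preadditive_category_scheme \<Rightarrow> 'o set \<Rightarrow> 'o set" where
  "tors_plus A U =
    U \<squnion>\<^bsub>tors A\<^esub> (\<Squnion>\<^bsub>tors A\<^esub> {U' \<in> carrier (tors A). Hasse_arrow (tors A) U' U})"

end

theory Submission
  imports Defs
begin

text \<open>
  Write \<open>F = U\<^sup>\<bottom>\<close> for a torsion class \<open>U\<close> and consider the class \<open>P\<close> of all objects \<open>X\<close> such that every
  arrow from \<open>X\<close> to an object of \<open>F\<close> has its cokernel in \<open>F\<close> (\<open>coker_class U\<close> below). The second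
  half of the theorem holds because all three conditions on \<open>T\<close> say that \<open>T \<subseteq> P\<close>.

  \<^item> \<open>P\<close> is a torsion class containing \<open>U\<close>. If \<open>T \<subseteq> P\<close>, then the heart \<open>T \<inter> F\<close> is closed under
    cokernels by the definition of \<open>P\<close>, while hearts are always closed under extensions and images.
    Conversely, suppose that some \<open>X \<rightarrow> Y\<close> with \<open>X \<in> T\<close> and \<open>Y \<in> F\<close> has a cokernel with a nonzero
    subobject \<open>V \<in> U\<close>. The preimage of \<open>V\<close> in \<open>Y\<close> is an object of the heart, and so is the image of
    \<open>X\<close>; their quotient \<open>V\<close> is not, so the heart is not closed under cokernels
    (\<open>torsion_in_cokernelE\<close>, \<open>ICE_interval_iff_subset_coker_class\<close>).
  \<^item> The interval from \<open>U\<close> to \<open>P\<close> is wide: a pushout turns arrows out of the kernel of a map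
    \<open>X \<rightarrow> Y\<close> into arrows out of \<open>X\<close> with the same cokernel (\<open>coker_class_kernel\<close>). As a wide heart
    is in particular ICE-closed, \<open>P\<close> is the largest possible upper end of a wide interval.
  \<^item> \<open>P = U\<^sup>+\<close>. If \<open>U'\<close> covers \<open>U\<close> and \<open>S\<close> is a nonzero object of least length in the heart of
    \<open>[U, U']\<close>, then the covering relation forces every object of \<open>U'\<close> outside \<open>U\<close> to have a nonzero
    arrow to \<open>S\<close>. This gives \<open>S \<in> P\<close>, hence \<open>U' \<subseteq> P\<close> (\<open>cover_subset_coker_class\<close>). If, on the other
    hand, a torsion class \<open>R\<close> contains \<open>U\<close> but not \<open>P\<close>, then a nonzero object \<open>S\<close> of least length in
    \<open>P \<inter> R\<^sup>\<bottom>\<close> is simple in the wide heart \<open>P \<inter> F\<close>, and \<open>U\<close> together with \<open>S\<close> generates a cover of \<open>U\<close>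
    not contained in \<open>R\<close> (\<open>coker_class_subset\<close>).

  For the first half, an ICE-closed \<open>C\<close> is the heart of the interval from the left orthogonal of \<open>C\<close>
  to the class of all \<open>X\<close> such that every image of \<open>X\<close> in an object of \<open>C\<close> lies in \<open>C\<close>
  (\<open>heart_image_class\<close>).
\<close>


section \<open>Morphisms in a preadditive category\<close>

context category
begin

lemma Hom_objs:
  assumes "f \<in> Hom A X Y"
  shows "X \<in> Obj A" "Y \<in> Obj A"
  using assms Dom_closed Cod_closed by (auto simp: Hom_def)

lemma HomD:
  assumes "f \<in> Hom A X Y"
  shows "f \<in> Arr A" "Dom A f = X" "Cod A f = Y"
  using assms by (auto simp: Hom_def)

lemma Arr_in_Hom: "f \<in> Arr A \<Longrightarrow> f \<in> Hom A (Dom A f) (Cod A f)"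
  by (simp add: Hom_def)

lemma monic_cancel:
  "\<lbrakk>monic A f; f \<in> Hom A X Y; g \<in> Hom A W X; h \<in> Hom A W X; f \<cdot> g = f \<cdot> h\<rbrakk> \<Longrightarrow> g = h"
  unfolding monic_def by (auto simp: HomD)

lemma epic_cancel:
  "\<lbrakk>epic A f; f \<in> Hom A X Y; g \<in> Hom A Y W; h \<in> Hom A Y W; g \<cdot> f = h \<cdot> f\<rbrakk> \<Longrightarrow> g = h"
  unfolding epic_def by (auto simp: HomD)

lemma monicI:
  assumes "f \<in> Hom A X Y"
    and "\<And>W g h. \<lbrakk>g \<in> Hom A W X; h \<in> Hom A W X; f \<cdot> g = f \<cdot> h\<rbrakk> \<Longrightarrow> g = h"
  shows "monic A f"
  unfolding monic_def using assms(2) HomD[OF assms(1)] by auto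

lemma epicI:
  assumes "f \<in> Hom A X Y"
    and "\<And>W g h. \<lbrakk>g \<in> Hom A Y W; h \<in> Hom A Y W; g \<cdot> f = h \<cdot> f\<rbrakk> \<Longrightarrow> g = h"
  shows "epic A f"
  unfolding epic_def using assms(2) HomD[OF assms(1)] by auto

lemma monic_Comp:
  assumes f: "f \<in> Hom A X Y" and g: "g \<in> Hom A Y Z" and "monic A f" "monic A g"
  shows "monic A (g \<cdot> f)"
proof (rule monicI[OF Comp_in_Hom[OF f g]])
  fix W a b assume a: "a \<in> Hom A W X" and b: "b \<in> Hom A W X" and eq: "(g \<cdot> f) \<cdot> a = (g \<cdot> f) \<cdot> b"
  have "g \<cdot> (f \<cdot> a) = g \<cdot> (f \<cdot> b)"
    using eq by (simp add: Comp_assoc[OF a f g] Comp_assoc[OF b f g])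
  then have "f \<cdot> a = f \<cdot> b"
    using monic_cancel[OF assms(4) g Comp_in_Hom[OF a f] Comp_in_Hom[OF b f]] by simp
  then show "a = b" by (rule monic_cancel[OF assms(3) f a b])
qed

lemma epic_Comp:
  assumes f: "f \<in> Hom A X Y" and g: "g \<in> Hom A Y Z" and "epic A f" "epic A g"
  shows "epic A (g \<cdot> f)"
proof (rule epicI[OF Comp_in_Hom[OF f g]])
  fix W a b assume a: "a \<in> Hom A Z W" and b: "b \<in> Hom A Z W" and eq: "a \<cdot> (g \<cdot> f) = b \<cdot> (g \<cdot> f)"
  have "(a \<cdot> g) \<cdot> f = (b \<cdot> g) \<cdot> f"
    using eq by (simp add: Comp_assoc[OF f g a] Comp_assoc[OF f g b])
  then have "a \<cdot> g = b \<cdot> g"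
    using epic_cancel[OF assms(3) f Comp_in_Hom[OF g a] Comp_in_Hom[OF g b]] by simp
  then show "a = b" by (rule epic_cancel[OF assms(4) g a b])
qed

lemma epic_of_Comp:
  assumes f: "f \<in> Hom A X Y" and g: "g \<in> Hom A Y Z" and "epic A (g \<cdot> f)"
  shows "epic A g"
proof (rule epicI[OF g])
  fix W a b assume a: "a \<in> Hom A Z W" and b: "b \<in> Hom A Z W" and eq: "a \<cdot> g = b \<cdot> g"
  have "a \<cdot> (g \<cdot> f) = b \<cdot> (g \<cdot> f)"
    by (simp add: Comp_assoc[OF f g a, symmetric] Comp_assoc[OF f g b, symmetric] eq)
  then show "a = b" by (rule epic_cancel[OF assms(3) Comp_in_Hom[OF f g] a b])
qed

lemma monic_of_Comp:
  assumes f: "f \<in> Hom A X Y" and g: "g \<in> Hom A Y Z" and "monic A (g \<cdot> f)"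
  shows "monic A f"
proof (rule monicI[OF f])
  fix W a b assume a: "a \<in> Hom A W X" and b: "b \<in> Hom A W X" and eq: "f \<cdot> a = f \<cdot> b"
  have "(g \<cdot> f) \<cdot> a = (g \<cdot> f) \<cdot> b"
    by (simp add: Comp_assoc[OF a f g] Comp_assoc[OF b f g] eq)
  then show "a = b" by (rule monic_cancel[OF assms(3) Comp_in_Hom[OF f g] a b])
qed

lemma Ide_monic: "X \<in> Obj A \<Longrightarrow> monic A (Ide A X)"
  by (rule monicI[OF Ide_in_Hom]) (simp_all add: Comp_Ide_left)

lemma Ide_epic: "X \<in> Obj A \<Longrightarrow> epic A (Ide A X)"
  by (rule epicI[OF Ide_in_Hom]) (simp_all add: Comp_Ide_right)

lemma iso_arrowE:
  assumes "iso_arrow A f" "f \<in> Hom A X Y"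
  obtains g where "g \<in> Hom A Y X" "g \<cdot> f = Ide A X" "f \<cdot> g = Ide A Y"
  using assms by (auto simp: iso_arrow_def Hom_def)

lemma iso_arrowI:
  assumes "f \<in> Hom A X Y" "g \<in> Hom A Y X" "g \<cdot> f = Ide A X" "f \<cdot> g = Ide A Y"
  shows "iso_arrow A f"
  using assms by (auto simp: iso_arrow_def Hom_def)

lemma iso_arrow_monic: "iso_arrow A f \<Longrightarrow> monic A f"
proof -
  assume iso: "iso_arrow A f"
  then have f: "f \<in> Hom A (Dom A f) (Cod A f)" by (simp add: iso_arrow_def Hom_def)
  obtain g where g: "g \<in> Hom A (Cod A f) (Dom A f)" "g \<cdot> f = Ide A (Dom A f)"
    using iso_arrowE[OF iso f] by blast
  show ?thesis
    using monic_of_Comp[OF f g(1)] Ide_monic[OF Hom_objs(1)[OF f]] g(2) by simp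
qed

lemma iso_arrow_epic: "iso_arrow A f \<Longrightarrow> epic A f"
proof -
  assume iso: "iso_arrow A f"
  then have f: "f \<in> Hom A (Dom A f) (Cod A f)" by (simp add: iso_arrow_def Hom_def)
  obtain g where g: "g \<in> Hom A (Cod A f) (Dom A f)" "f \<cdot> g = Ide A (Cod A f)"
    using iso_arrowE[OF iso f] by blast
  show ?thesis
    using epic_of_Comp[OF g(1) f] Ide_epic[OF Hom_objs(2)[OF f]] g(2) by simp
qed

lemma isomorphicI: "\<lbrakk>iso_arrow A f; f \<in> Hom A X Y\<rbrakk> \<Longrightarrow> isomorphic A X Y"
  by (auto simp: isomorphic_def)

lemma isomorphic_sym: "isomorphic A X Y \<Longrightarrow> isomorphic A Y X"
  unfolding isomorphic_def by (metis iso_arrowE iso_arrowI)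

end

context preadditive_category
begin

lemma Zero_in_Hom:
  assumes "X \<in> Obj A" "Y \<in> Obj A"
  shows "Zero A X Y \<in> Hom A X Y"
proof -
  interpret G: comm_group "Hom_group A X Y" by (rule Hom_comm_group[OF assms])
  show ?thesis using G.one_closed by (simp add: Hom_group_def)
qed

lemma Plus_in_Hom:
  assumes "f \<in> Hom A X Y" "g \<in> Hom A X Y"
  shows "f \<oplus>\<^sub>h g \<in> Hom A X Y"
proof -
  interpret G: comm_group "Hom_group A X Y" by (rule Hom_comm_group[OF Hom_objs[OF assms(1)]])
  show ?thesis using G.m_closed[of f g] assms by (simp add: Hom_group_def)
qed

lemma Plus_Zero:
  assumes "f \<in> Hom A X Y"
  shows "f \<oplus>\<^sub>h Zero A X Y = f" "Zero A X Y \<oplus>\<^sub>h f = f"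
proof -
  interpret G: comm_group "Hom_group A X Y" by (rule Hom_comm_group[OF Hom_objs[OF assms]])
  show "f \<oplus>\<^sub>h Zero A X Y = f" "Zero A X Y \<oplus>\<^sub>h f = f"
    using G.r_one[of f] G.l_one[of f] assms by (simp_all add: Hom_group_def)
qed

lemma Plus_cancel:
  assumes "f \<in> Hom A X Y" "g \<in> Hom A X Y" "h \<in> Hom A X Y" "f \<oplus>\<^sub>h h = g \<oplus>\<^sub>h h"
  shows "f = g"
proof -
  interpret G: comm_group "Hom_group A X Y" by (rule Hom_comm_group[OF Hom_objs[OF assms(1)]])
  show ?thesis
    using G.right_cancel[of h f g] assms by (simp add: Hom_group_def)
qed

lemma Plus_commute:
  assumes "f \<in> Hom A X Y" "g \<in> Hom A X Y"
  shows "f \<oplus>\<^sub>h g = g \<oplus>\<^sub>h f"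
proof -
  interpret G: comm_group "Hom_group A X Y" by (rule Hom_comm_group[OF Hom_objs[OF assms(1)]])
  show ?thesis using G.m_comm[of f g] assms by (simp add: Hom_group_def)
qed

lemma differenceE:
  assumes "f \<in> Hom A X Y" "g \<in> Hom A X Y"
  obtains d where "d \<in> Hom A X Y" "f = d \<oplus>\<^sub>h g"
proof -
  interpret G: comm_group "Hom_group A X Y" by (rule Hom_comm_group[OF Hom_objs[OF assms(1)]])
  let ?d = "f \<otimes>\<^bsub>Hom_group A X Y\<^esub> inv\<^bsub>Hom_group A X Y\<^esub> g"
  have fg: "f \<in> carrier (Hom_group A X Y)" "g \<in> carrier (Hom_group A X Y)"
    using assms by (simp_all add: Hom_group_def)
  have "?d \<in> carrier (Hom_group A X Y)" using fg by simp
  moreover have "f = ?d \<otimes>\<^bsub>Hom_group A X Y\<^esub> g" using fg by (simp add: G.m_assoc)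
  ultimately show ?thesis by (intro that[of ?d]) (simp_all add: Hom_group_def)
qed

lemma Comp_Zero_right:
  assumes "g \<in> Hom A Y Z" "X \<in> Obj A"
  shows "g \<cdot> Zero A X Y = Zero A X Z"
proof -
  note o = Hom_objs[OF assms(1)]
  let ?z = "Zero A X Y"
  have z: "?z \<in> Hom A X Y" using Zero_in_Hom assms o by blast
  have gz: "g \<cdot> ?z \<in> Hom A X Z" by (rule Comp_in_Hom[OF z assms(1)])
  have "g \<cdot> ?z = g \<cdot> (?z \<oplus>\<^sub>h ?z)" by (simp add: Plus_Zero[OF z])
  also have "\<dots> = g \<cdot> ?z \<oplus>\<^sub>h g \<cdot> ?z" by (rule Comp_Plus_right[OF z z assms(1)])
  finally have "Zero A X Z \<oplus>\<^sub>h g \<cdot> ?z = g \<cdot> ?z \<oplus>\<^sub>h g \<cdot> ?z" by (simp add: Plus_Zero[OF gz])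
  then show ?thesis using Plus_cancel[OF _ gz gz] Zero_in_Hom assms o by metis
qed

lemma Comp_Zero_left:
  assumes "f \<in> Hom A X Y" "Z \<in> Obj A"
  shows "Zero A Y Z \<cdot> f = Zero A X Z"
proof -
  note o = Hom_objs[OF assms(1)]
  let ?z = "Zero A Y Z"
  have z: "?z \<in> Hom A Y Z" using Zero_in_Hom assms o by blast
  have gz: "?z \<cdot> f \<in> Hom A X Z" by (rule Comp_in_Hom[OF assms(1) z])
  have "?z \<cdot> f = (?z \<oplus>\<^sub>h ?z) \<cdot> f" by (simp add: Plus_Zero[OF z])
  also have "\<dots> = ?z \<cdot> f \<oplus>\<^sub>h ?z \<cdot> f" by (rule Comp_Plus_left[OF assms(1) z z])
  finally have "Zero A X Z \<oplus>\<^sub>h ?z \<cdot> f = ?z \<cdot> f \<oplus>\<^sub>h ?z \<cdot> f" by (simp add: Plus_Zero[OF gz])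
  then show ?thesis using Plus_cancel[OF _ gz gz] Zero_in_Hom assms o by metis
qed

lemma Comp_zero_mid:
  assumes f: "f \<in> Hom A W X" and g: "g \<in> Hom A X Y" and h: "h \<in> Hom A Y Z"
  shows "g \<cdot> f = Zero A W Y \<Longrightarrow> (h \<cdot> g) \<cdot> f = Zero A W Z"
    and "h \<cdot> g = Zero A X Z \<Longrightarrow> h \<cdot> (g \<cdot> f) = Zero A W Z"
  using Comp_assoc[OF f g h] Comp_Zero_right[OF h Hom_objs(1)[OF f]]
    Comp_Zero_left[OF f Hom_objs(2)[OF h]] by simp_all

lemma monic_cancel_zero:
  assumes "monic A f" and f: "f \<in> Hom A X Y" and g: "g \<in> Hom A W X" and "f \<cdot> g = Zero A W Y"
  shows "g = Zero A W X"
  using monic_cancel[OF assms(1) f g Zero_in_Hom] Comp_Zero_right[OF f] assms(4)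
    Hom_objs[OF f] Hom_objs[OF g] by simp

lemma epic_cancel_zero:
  assumes "epic A f" and f: "f \<in> Hom A X Y" and g: "g \<in> Hom A Y W" and "g \<cdot> f = Zero A X W"
  shows "g = Zero A Y W"
  using epic_cancel[OF assms(1) f g Zero_in_Hom] Comp_Zero_left[OF f] assms(4)
    Hom_objs[OF f] Hom_objs[OF g] by simp

lemma monicI_zero:
  assumes f: "f \<in> Hom A X Y"
    and *: "\<And>W g. \<lbrakk>g \<in> Hom A W X; f \<cdot> g = Zero A W Y\<rbrakk> \<Longrightarrow> g = Zero A W X"
  shows "monic A f"
proof (rule monicI[OF f])
  fix W g h assume g: "g \<in> Hom A W X" and h: "h \<in> Hom A W X" and eq: "f \<cdot> g = f \<cdot> h"
  obtain d where d: "d \<in> Hom A W X" "g = d \<oplus>\<^sub>h h" using differenceE[OF g h] .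
  note fh = Comp_in_Hom[OF h f] and fd = Comp_in_Hom[OF d(1) f]
  have "f \<cdot> d \<oplus>\<^sub>h f \<cdot> h = Zero A W Y \<oplus>\<^sub>h f \<cdot> h"
    using eq d(2) Comp_Plus_right[OF d(1) h f] Plus_Zero[OF fh] by simp
  then have "f \<cdot> d = Zero A W Y"
    using Plus_cancel[OF fd _ fh] Zero_in_Hom Hom_objs[OF fh] by simp
  then have "d = Zero A W X" using * d by simp
  then show "g = h" using d Plus_Zero[OF h] by simp
qed

lemma epicI_zero:
  assumes f: "f \<in> Hom A X Y"
    and *: "\<And>W g. \<lbrakk>g \<in> Hom A Y W; g \<cdot> f = Zero A X W\<rbrakk> \<Longrightarrow> g = Zero A Y W"
  shows "epic A f"
proof (rule epicI[OF f])
  fix W g h assume g: "g \<in> Hom A Y W" and h: "h \<in> Hom A Y W" and eq: "g \<cdot> f = h \<cdot> f"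
  obtain d where d: "d \<in> Hom A Y W" "g = d \<oplus>\<^sub>h h" using differenceE[OF g h] .
  note fh = Comp_in_Hom[OF f h] and fd = Comp_in_Hom[OF f d(1)]
  have "d \<cdot> f \<oplus>\<^sub>h h \<cdot> f = Zero A X W \<oplus>\<^sub>h h \<cdot> f"
    using eq d(2) Comp_Plus_left[OF f d(1) h] Plus_Zero[OF fh] by simp
  then have "d \<cdot> f = Zero A X W"
    using Plus_cancel[OF fd _ fh] Zero_in_Hom Hom_objs[OF fh] by simp
  then have "d = Zero A Y W" using * d by simp
  then show "g = h" using d Plus_Zero[OF h] by simp
qed

lemma zero_object_iff: "zero_object A X \<longleftrightarrow> X \<in> Obj A \<and> Ide A X = Zero A X X"
proof
  assume "zero_object A X"
  then show "X \<in> Obj A \<and> Ide A X = Zero A X X"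
    unfolding zero_object_def using Ide_in_Hom Zero_in_Hom by metis
next
  assume X: "X \<in> Obj A \<and> Ide A X = Zero A X X"
  have "f = Zero A Y X" if "f \<in> Hom A Y X" for Y f
    using Comp_Ide_left[OF that] Comp_Zero_left[OF that, of X] X by simp
  moreover have "f = Zero A X Y" if "f \<in> Hom A X Y" for Y f
    using Comp_Ide_right[OF that] Comp_Zero_right[OF that, of X] X by simp
  ultimately show "zero_object A X"
    unfolding zero_object_def using X Zero_in_Hom by metis
qed

lemma zero_object_Hom:
  assumes "zero_object A X"
  shows "f \<in> Hom A X Y \<Longrightarrow> f = Zero A X Y" "f \<in> Hom A Y X \<Longrightarrow> f = Zero A Y X"
  using assms unfolding zero_object_def by (metis Zero_in_Hom Hom_objs)+

lemma zero_object_monic: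
  assumes "monic A m" "m \<in> Hom A X Y" "zero_object A Y"
  shows "zero_object A X"
proof -
  note X = Hom_objs(1)[OF assms(2)]
  have "m \<cdot> Ide A X = Zero A X Y"
    using Comp_Ide_right[OF assms(2)] zero_object_Hom(2)[OF assms(3,2)] by simp
  then show ?thesis
    using monic_cancel_zero[OF assms(1,2) Ide_in_Hom[OF X]] X by (simp add: zero_object_iff)
qed

lemma zero_object_epic:
  assumes "epic A e" "e \<in> Hom A X Y" "zero_object A X"
  shows "zero_object A Y"
proof -
  note Y = Hom_objs(2)[OF assms(2)]
  have "Ide A Y \<cdot> e = Zero A X Y"
    using Comp_Ide_left[OF assms(2)] zero_object_Hom(1)[OF assms(3,2)] by simp
  then show ?thesis
    using epic_cancel_zero[OF assms(1,2) Ide_in_Hom[OF Y]] Y by (simp add: zero_object_iff)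
qed

lemma epic_Zero_object:
  assumes "epic A (Zero A X Y)" "X \<in> Obj A" "Y \<in> Obj A"
  shows "zero_object A Y"
  using epic_cancel_zero[OF assms(1) Zero_in_Hom[OF assms(2,3)] Ide_in_Hom[OF assms(3)]]
    Comp_Ide_left[OF Zero_in_Hom[OF assms(2,3)]] assms by (simp add: zero_object_iff)

lemma zero_objects_isomorphic:
  assumes "zero_object A X" "zero_object A Y"
  shows "isomorphic A X Y"
proof -
  have o: "X \<in> Obj A" "Y \<in> Obj A" using assms by (auto simp: zero_object_iff)
  note f = Zero_in_Hom[OF o] and g = Zero_in_Hom[OF o(2,1)]
  have "iso_arrow A (Zero A X Y)"
    using iso_arrowI[OF f g] Comp_Zero_left[OF f o(1)] Comp_Zero_left[OF g o(2)] assms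
    by (simp add: zero_object_iff)
  then show ?thesis using f isomorphicI by blast
qed


section \<open>Kernels and cokernels\<close>

lemma kernel_Hom: "\<lbrakk>is_kernel A f k; f \<in> Hom A X Y\<rbrakk> \<Longrightarrow> k \<in> Hom A (Dom A k) X"
  by (auto simp: is_kernel_def Hom_def)

lemma cokernel_Hom: "\<lbrakk>is_cokernel A f c; f \<in> Hom A X Y\<rbrakk> \<Longrightarrow> c \<in> Hom A Y (Cod A c)"
  by (auto simp: is_cokernel_def Hom_def)

lemma kernel_zero: "\<lbrakk>is_kernel A f k; f \<in> Hom A X Y; k \<in> Hom A K X\<rbrakk> \<Longrightarrow> f \<cdot> k = Zero A K Y"
  by (auto simp: is_kernel_def Hom_def)

lemma cokernel_zero: "\<lbrakk>is_cokernel A f c; f \<in> Hom A X Y; c \<in> Hom A Y C\<rbrakk> \<Longrightarrow> c \<cdot> f = Zero A X C"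
  by (auto simp: is_cokernel_def Hom_def)

lemma kernel_lift:
  assumes "is_kernel A f k" "f \<in> Hom A X Y" "k \<in> Hom A K X" "h \<in> Hom A W X" "f \<cdot> h = Zero A W Y"
  obtains u where "u \<in> Hom A W K" "k \<cdot> u = h"
proof -
  have "\<exists>!u. u \<in> Hom A W K \<and> k \<cdot> u = h"
    using assms unfolding is_kernel_def by (metis HomD)
  then show ?thesis using that by blast
qed

lemma cokernel_desc:
  assumes "is_cokernel A f c" "f \<in> Hom A X Y" "c \<in> Hom A Y C" "h \<in> Hom A Y W" "h \<cdot> f = Zero A X W"
  obtains u where "u \<in> Hom A C W" "u \<cdot> c = h"
proof -
  have "\<exists>!u. u \<in> Hom A C W \<and> u \<cdot> c = h"
    using assms unfolding is_cokernel_def by (metis HomD)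
  then show ?thesis using that by blast
qed

lemma kernel_monic:
  assumes "is_kernel A f k"
  shows "monic A k"
proof -
  have f: "f \<in> Hom A (Dom A f) (Cod A f)" and k: "k \<in> Hom A (Dom A k) (Dom A f)"
    using assms by (auto simp: is_kernel_def Hom_def)
  show ?thesis
  proof (rule monicI[OF k])
    fix W g h assume g: "g \<in> Hom A W (Dom A k)" and h: "h \<in> Hom A W (Dom A k)"
      and eq: "k \<cdot> g = k \<cdot> h"
    have "f \<cdot> (k \<cdot> g) = Zero A W (Cod A f)"
      by (rule Comp_zero_mid(2)[OF g k f kernel_zero[OF assms f k]])
    then have "\<exists>!u. u \<in> Hom A W (Dom A k) \<and> k \<cdot> u = k \<cdot> g"
      using assms Comp_in_Hom[OF g k] unfolding is_kernel_def by blast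
    then show "g = h" using g h eq by metis
  qed
qed

lemma cokernel_epic:
  assumes "is_cokernel A f c"
  shows "epic A c"
proof -
  have f: "f \<in> Hom A (Dom A f) (Cod A f)" and c: "c \<in> Hom A (Cod A f) (Cod A c)"
    using assms by (auto simp: is_cokernel_def Hom_def)
  show ?thesis
  proof (rule epicI[OF c])
    fix W g h assume g: "g \<in> Hom A (Cod A c) W" and h: "h \<in> Hom A (Cod A c) W"
      and eq: "g \<cdot> c = h \<cdot> c"
    have "(g \<cdot> c) \<cdot> f = Zero A (Dom A f) W"
      by (rule Comp_zero_mid(1)[OF f c g cokernel_zero[OF assms f c]])
    then have "\<exists>!u. u \<in> Hom A (Cod A c) W \<and> u \<cdot> c = g \<cdot> c"
      using assms Comp_in_Hom[OF c g] unfolding is_cokernel_def by blast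
    then show "g = h" using g h eq by metis
  qed
qed

lemma is_kernelI:
  assumes f: "f \<in> Hom A X Y" and k: "k \<in> Hom A K X" and "f \<cdot> k = Zero A K Y" "monic A k"
    and "\<And>W h. \<lbrakk>h \<in> Hom A W X; f \<cdot> h = Zero A W Y\<rbrakk> \<Longrightarrow> \<exists>u\<in>Hom A W K. k \<cdot> u = h"
  shows "is_kernel A f k"
proof -
  have "\<exists>!u. u \<in> Hom A W K \<and> k \<cdot> u = h" if "h \<in> Hom A W X" "f \<cdot> h = Zero A W Y" for W h
    using assms(5)[OF that] monic_cancel[OF assms(4) k] by metis
  then show ?thesis
    unfolding is_kernel_def using assms(3) by (simp add: HomD[OF f] HomD[OF k])
qed

lemma is_cokernelI:
  assumes f: "f \<in> Hom A X Y" and c: "c \<in> Hom A Y C" and "c \<cdot> f = Zero A X C" "epic A c"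
    and "\<And>W h. \<lbrakk>h \<in> Hom A Y W; h \<cdot> f = Zero A X W\<rbrakk> \<Longrightarrow> \<exists>u\<in>Hom A C W. u \<cdot> c = h"
  shows "is_cokernel A f c"
proof -
  have "\<exists>!u. u \<in> Hom A C W \<and> u \<cdot> c = h" if "h \<in> Hom A Y W" "h \<cdot> f = Zero A X W" for W h
    using assms(5)[OF that] epic_cancel[OF assms(4) c] by metis
  then show ?thesis
    unfolding is_cokernel_def using assms(3) by (simp add: HomD[OF f] HomD[OF c])
qed

lemma cokernels_isomorphic:
  assumes c: "is_cokernel A f c" and d: "is_cokernel A f d"
  shows "isomorphic A (Cod A c) (Cod A d)"
proof -
  have f: "f \<in> Hom A (Dom A f) (Cod A f)" using c by (simp add: is_cokernel_def Hom_def)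
  note cH = cokernel_Hom[OF c f] and dH = cokernel_Hom[OF d f]
  obtain u where u: "u \<in> Hom A (Cod A c) (Cod A d)" "u \<cdot> c = d"
    using cokernel_desc[OF c f cH dH cokernel_zero[OF d f dH]] .
  obtain v where v: "v \<in> Hom A (Cod A d) (Cod A c)" "v \<cdot> d = c"
    using cokernel_desc[OF d f dH cH cokernel_zero[OF c f cH]] .
  have "v \<cdot> u = Ide A (Cod A c)"
  proof (rule epic_cancel[OF cokernel_epic[OF c] cH Comp_in_Hom[OF u(1) v(1)]])
    show "Ide A (Cod A c) \<in> Hom A (Cod A c) (Cod A c)" by (rule Ide_in_Hom[OF Hom_objs(2)[OF cH]])
    show "(v \<cdot> u) \<cdot> c = Ide A (Cod A c) \<cdot> c"
      by (simp add: Comp_assoc[OF cH u(1) v(1)] u(2) v(2) Comp_Ide_left[OF cH])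
  qed
  moreover have "u \<cdot> v = Ide A (Cod A d)"
  proof (rule epic_cancel[OF cokernel_epic[OF d] dH Comp_in_Hom[OF v(1) u(1)]])
    show "Ide A (Cod A d) \<in> Hom A (Cod A d) (Cod A d)" by (rule Ide_in_Hom[OF Hom_objs(2)[OF dH]])
    show "(u \<cdot> v) \<cdot> d = Ide A (Cod A d) \<cdot> d"
      by (simp add: Comp_assoc[OF dH v(1) u(1)] u(2) v(2) Comp_Ide_left[OF dH])
  qed
  ultimately show ?thesis using iso_arrowI[OF u(1) v(1)] isomorphicI[OF _ u(1)] by blast
qed

lemma short_exactD:
  assumes "short_exact A f g"
  shows "is_kernel A g f" "is_cokernel A f g" "monic A f" "epic A g"
  using assms kernel_monic cokernel_epic by (auto simp: short_exact_def)

lemma cokernel_of_epic_Comp: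
  assumes e: "e \<in> Hom A X I" "epic A e" and m: "m \<in> Hom A I Y"
  shows "is_cokernel A (m \<cdot> e) c \<longleftrightarrow> is_cokernel A m c"
proof -
  have *: "h \<cdot> (m \<cdot> e) = Zero A X W \<longleftrightarrow> h \<cdot> m = Zero A I W" if h: "h \<in> Hom A Y W" for h W
    using epic_cancel_zero[OF e(2,1) Comp_in_Hom[OF m h]] Comp_assoc[OF e(1) m h]
      Comp_Zero_left[OF e(1) Hom_objs(2)[OF h]] by auto
  note me = HomD[OF Comp_in_Hom[OF e(1) m]]
  show ?thesis
  proof (cases "c \<in> Arr A \<and> Dom A c = Y")
    case True
    then have c: "c \<in> Hom A Y (Cod A c)" by (simp add: Hom_def)
    show ?thesis
      unfolding is_cokernel_def using * *[OF c] by (simp add: me HomD[OF m]) 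
  next
    case False
    then show ?thesis unfolding is_cokernel_def by (auto simp: me HomD[OF m])
  qed
qed

lemma kernel_of_monic_Comp:
  assumes e: "e \<in> Hom A X I" and m: "m \<in> Hom A I Y" "monic A m"
  shows "is_kernel A (m \<cdot> e) k \<longleftrightarrow> is_kernel A e k"
proof -
  have *: "(m \<cdot> e) \<cdot> h = Zero A W Y \<longleftrightarrow> e \<cdot> h = Zero A W I" if h: "h \<in> Hom A W X" for h W
    using monic_cancel_zero[OF m(2,1) Comp_in_Hom[OF h e]] Comp_assoc[OF h e m(1)]
      Comp_Zero_right[OF m(1) Hom_objs(1)[OF h]] by auto
  note me = HomD[OF Comp_in_Hom[OF e m(1)]]
  show ?thesis
  proof (cases "k \<in> Arr A \<and> Cod A k = X")
    case True
    then have k: "k \<in> Hom A (Dom A k) X" by (simp add: Hom_def)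
    show ?thesis unfolding is_kernel_def using * *[OF k] by (simp add: me HomD[OF e])
  next
    case False
    then show ?thesis unfolding is_kernel_def by (auto simp: me HomD[OF e])
  qed
qed

end


section \<open>Images and pushouts in an abelian category\<close>

context abelian_category
begin

lemma kernelE:
  assumes "f \<in> Hom A X Y"
  obtains K k where "k \<in> Hom A K X" "is_kernel A f k"
  using kernel_exists[OF HomD(1)[OF assms]] kernel_Hom assms by blast

lemma cokernelE:
  assumes "f \<in> Hom A X Y"
  obtains C c where "c \<in> Hom A Y C" "is_cokernel A f c"
  using cokernel_exists[OF HomD(1)[OF assms]] cokernel_Hom assms by blast

text \<open>
  A monic arrow is the kernel of some \<open>g\<close>, and \<open>g\<close> factors through the cokernel, so that whatever
  the cokernel kills is killed by \<open>g\<close> too.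
\<close>

lemma monic_kernel_of_cokernel:
  assumes "monic A f" and f: "f \<in> Hom A X Y" and c: "is_cokernel A f c"
  shows "is_kernel A c f"
proof -
  obtain g where g: "is_kernel A g f" using monic_is_kernel[OF assms(1)] by blast
  have gH: "g \<in> Hom A Y (Cod A g)" using g HomD[OF f] by (auto simp: is_kernel_def Hom_def)
  note cH = cokernel_Hom[OF c f]
  obtain g' where g': "g' \<in> Hom A (Cod A c) (Cod A g)" "g' \<cdot> c = g"
    using cokernel_desc[OF c f cH gH kernel_zero[OF g gH f]] .
  show ?thesis
  proof (rule is_kernelI[OF cH f cokernel_zero[OF c f cH] assms(1)])
    fix W h assume h: "h \<in> Hom A W Y" and 0: "c \<cdot> h = Zero A W (Cod A c)"
    have "g \<cdot> h = Zero A W (Cod A g)"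
      using Comp_zero_mid(1)[OF h cH g'(1) 0] g'(2) by simp
    then show "\<exists>u\<in>Hom A W X. f \<cdot> u = h" using kernel_lift[OF g gH f h] by metis
  qed
qed

lemma epic_cokernel_of_kernel:
  assumes "epic A f" and f: "f \<in> Hom A X Y" and k: "is_kernel A f k"
  shows "is_cokernel A k f"
proof -
  obtain g where g: "is_cokernel A g f" using epic_is_cokernel[OF assms(1)] by blast
  have gH: "g \<in> Hom A (Dom A g) X" using g HomD[OF f] by (auto simp: is_cokernel_def Hom_def)
  note kH = kernel_Hom[OF k f]
  obtain g' where g': "g' \<in> Hom A (Dom A g) (Dom A k)" "k \<cdot> g' = g"
    using kernel_lift[OF k f kH gH cokernel_zero[OF g gH f]] .
  show ?thesis
  proof (rule is_cokernelI[OF kH f kernel_zero[OF k f kH] assms(1)])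
    fix W h assume h: "h \<in> Hom A X W" and 0: "h \<cdot> k = Zero A (Dom A k) W"
    have "h \<cdot> g = Zero A (Dom A g) W"
      using Comp_zero_mid(2)[OF g'(1) kH h 0] g'(2) by simp
    then show "\<exists>u\<in>Hom A Y W. u \<cdot> f = h" using cokernel_desc[OF g gH f h] by metis
  qed
qed

lemma monic_epic_iso:
  assumes "monic A f" "epic A f" and f: "f \<in> Hom A X Y"
  shows "iso_arrow A f"
proof -
  obtain C c where c: "c \<in> Hom A Y C" "is_cokernel A f c" using cokernelE[OF f] .
  note k = monic_kernel_of_cokernel[OF assms(1) f c(2)]
  note Y = Hom_objs(2)[OF f] and X = Hom_objs(1)[OF f]
  have "c = Zero A Y C" by (rule epic_cancel_zero[OF assms(2) f c(1) cokernel_zero[OF c(2) f c(1)]])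
  then have "c \<cdot> Ide A Y = Zero A Y C" using Comp_Ide_right[OF c(1)] by simp
  then obtain t where t: "t \<in> Hom A Y X" "f \<cdot> t = Ide A Y"
    using kernel_lift[OF k c(1) f Ide_in_Hom[OF Y]] by blast
  have "f \<cdot> (t \<cdot> f) = f \<cdot> Ide A X"
    using Comp_assoc[OF f t(1) f] t(2) Comp_Ide_left[OF f] Comp_Ide_right[OF f] by simp
  then have "t \<cdot> f = Ide A X"
    using monic_cancel[OF assms(1) f Comp_in_Hom[OF f t(1)] Ide_in_Hom[OF X]] by simp
  then show ?thesis using iso_arrowI[OF f t(1)] t(2) by simp
qed

lemma cokernel_zero_epic:
  assumes f: "f \<in> Hom A X Y" and c: "is_cokernel A f c" and "zero_object A (Cod A c)"
  shows "epic A f"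
proof (rule epicI_zero[OF f])
  fix W g assume g: "g \<in> Hom A Y W" and 0: "g \<cdot> f = Zero A X W"
  note cH = cokernel_Hom[OF c f]
  obtain u where u: "u \<in> Hom A (Cod A c) W" "u \<cdot> c = g" using cokernel_desc[OF c f cH g 0] .
  then show "g = Zero A Y W"
    using zero_object_Hom(1)[OF assms(3) u(1)] Comp_Zero_left[OF cH Hom_objs(2)[OF g]] by simp
qed

lemma kernel_zero_monic:
  assumes f: "f \<in> Hom A X Y" and k: "is_kernel A f k" and "zero_object A (Dom A k)"
  shows "monic A f"
proof (rule monicI_zero[OF f])
  fix W g assume g: "g \<in> Hom A W X" and 0: "f \<cdot> g = Zero A W Y"
  note kH = kernel_Hom[OF k f]
  obtain u where u: "u \<in> Hom A W (Dom A k)" "k \<cdot> u = g" using kernel_lift[OF k f kH g 0] .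
  then show "g = Zero A W X"
    using zero_object_Hom(2)[OF assms(3) u(1)] Comp_Zero_right[OF kH Hom_objs(1)[OF g]] by simp
qed

text \<open>
  Let \<open>m\<close> be the kernel of the cokernel of \<open>f\<close>. If \<open>w\<close> kills the corestriction of \<open>f\<close> to the
  image, then \<open>f\<close> factors through the smaller subobject \<open>ker w\<close>; but that subobject is itself the
  kernel of some arrow killing \<open>f\<close>, so it contains the whole image.
\<close>

lemma image_factorization:
  assumes f: "f \<in> Hom A X Y"
  obtains I e m where "e \<in> Hom A X I" "epic A e" "m \<in> Hom A I Y" "monic A m" "f = m \<cdot> e"
proof -
  obtain C c where c: "c \<in> Hom A Y C" "is_cokernel A f c" using cokernelE[OF f] .
  obtain I m where m: "m \<in> Hom A I Y" "is_kernel A c m" using kernelE[OF c(1)] .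
  note mm = kernel_monic[OF m(2)] and I = Hom_objs(1)[OF m(1)]
  obtain e where e: "e \<in> Hom A X I" "m \<cdot> e = f"
    using kernel_lift[OF m(2) c(1) m(1) f cokernel_zero[OF c(2) f c(1)]] .
  have "epic A e"
  proof (rule epicI_zero[OF e(1)])
    fix W w assume w: "w \<in> Hom A I W" and 0: "w \<cdot> e = Zero A X W"
    obtain K k where k: "k \<in> Hom A K I" "is_kernel A w k" using kernelE[OF w] .
    obtain e' where e': "e' \<in> Hom A X K" "k \<cdot> e' = e" using kernel_lift[OF k(2) w k(1) e(1) 0] .
    note mk = Comp_in_Hom[OF k(1) m(1)]
    obtain G g where g: "g \<in> Hom A Y G" "is_cokernel A (m \<cdot> k) g" using cokernelE[OF mk] .
    have ker: "is_kernel A g (m \<cdot> k)"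
      by (rule monic_kernel_of_cokernel[OF monic_Comp[OF k(1) m(1) kernel_monic[OF k(2)] mm] mk g(2)])
    have "g \<cdot> f = Zero A X G"
      using Comp_zero_mid(2)[OF e'(1) mk g(1) kernel_zero[OF ker g(1) mk]]
        Comp_assoc[OF e'(1) k(1) m(1)] e'(2) e(2) by simp
    then obtain g' where g': "g' \<in> Hom A C G" "g' \<cdot> c = g"
      using cokernel_desc[OF c(2) f c(1) g(1)] by blast
    have "g \<cdot> m = Zero A I G"
      using Comp_zero_mid(1)[OF m(1) c(1) g'(1) kernel_zero[OF m(2) c(1) m(1)]] g'(2) by simp
    then obtain t where t: "t \<in> Hom A I K" "(m \<cdot> k) \<cdot> t = m"
      using kernel_lift[OF ker g(1) mk m(1)] by blast
    have "m \<cdot> (k \<cdot> t) = m \<cdot> Ide A I"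
      using t(2) Comp_assoc[OF t(1) k(1) m(1)] Comp_Ide_right[OF m(1)] by simp
    then have kt: "k \<cdot> t = Ide A I"
      using monic_cancel[OF mm m(1) Comp_in_Hom[OF t(1) k(1)] Ide_in_Hom[OF I]] by simp
    have "w \<cdot> (k \<cdot> t) = Zero A I W"
      by (rule Comp_zero_mid(2)[OF t(1) k(1) w kernel_zero[OF k(2) w k(1)]])
    then show "w = Zero A I W" using kt Comp_Ide_right[OF w] by simp
  qed
  then show ?thesis using that e m(1) mm by metis
qed

lemma epic_monic_is_image:
  assumes e: "e \<in> Hom A X I" "epic A e" and m: "m \<in> Hom A I Y" "monic A m"
  shows "is_image A (m \<cdot> e) m"
proof -
  obtain C c where c: "c \<in> Hom A Y C" "is_cokernel A m c" using cokernelE[OF m(1)] .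
  show ?thesis
    unfolding is_image_def
    using c(2) cokernel_of_epic_Comp[OF e m(1)] monic_kernel_of_cokernel[OF m(2,1)] by blast
qed

lemma is_imageE:
  assumes im: "is_image A f m" and f: "f \<in> Hom A X Y"
  obtains e where "e \<in> Hom A X (Dom A m)" "epic A e" "m \<in> Hom A (Dom A m) Y" "monic A m" "f = m \<cdot> e"
proof -
  obtain c where c: "is_cokernel A f c" and k: "is_kernel A c m" using im by (auto simp: is_image_def)
  note cH = cokernel_Hom[OF c f]
  note mH = kernel_Hom[OF k cH] and mm = kernel_monic[OF k]
  obtain I e n where n: "e \<in> Hom A X I" "epic A e" "n \<in> Hom A I Y" "monic A n" "f = n \<cdot> e"
    using image_factorization[OF f] .
  have "is_kernel A c n"
    using c cokernel_of_epic_Comp[OF n(1,2,3)] n(5) monic_kernel_of_cokernel[OF n(4,3)] by blast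
  note kn = this
  obtain s where s: "s \<in> Hom A (Dom A m) I" "n \<cdot> s = m"
    using kernel_lift[OF kn cH n(3) mH kernel_zero[OF k cH mH]] .
  obtain t where t: "t \<in> Hom A I (Dom A m)" "m \<cdot> t = n"
    using kernel_lift[OF k cH mH n(3) kernel_zero[OF kn cH n(3)]] .
  note I = Hom_objs(1)[OF n(3)] and M = Hom_objs(1)[OF mH]
  have "m \<cdot> (t \<cdot> s) = m \<cdot> Ide A (Dom A m)"
    using Comp_assoc[OF s(1) t(1) mH] s t Comp_Ide_right[OF mH] by simp
  then have "t \<cdot> s = Ide A (Dom A m)"
    using monic_cancel[OF mm mH Comp_in_Hom[OF s(1) t(1)] Ide_in_Hom[OF M]] by simp
  then have "epic A t" using epic_of_Comp[OF s(1) t(1)] Ide_epic[OF M] by simp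
  then have "epic A (t \<cdot> e)" using epic_Comp[OF n(1) t(1) n(2)] by simp
  moreover have "f = m \<cdot> (t \<cdot> e)" using Comp_assoc[OF n(1) t(1) mH] t(2) n(5) by simp
  ultimately show ?thesis using that[OF Comp_in_Hom[OF n(1) t(1)] _ mH mm] by simp
qed

text \<open>
  The pushout of \<open>k\<close> along \<open>g\<close> is the cokernel of \<open>(k, -g) : K \<rightarrow> X \<oplus> Z\<close>. When \<open>k\<close> is monic so is
  \<open>(k, -g)\<close>, which is then the kernel of that cokernel; this is what makes the exactness
  statements about \<open>x\<close> and \<open>z\<close> computable.
\<close>

lemma pushoutE:
  assumes k: "k \<in> Hom A K X" and g: "g \<in> Hom A K Z" and mk: "monic A k"
  obtains P x z where "x \<in> Hom A X P" "z \<in> Hom A Z P" "x \<cdot> k = z \<cdot> g" "monic A z"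
    "\<forall>W. \<forall>a\<in>Hom A X W. \<forall>b\<in>Hom A Z W. a \<cdot> k = b \<cdot> g \<longrightarrow>
       (\<exists>w\<in>Hom A P W. w \<cdot> x = a \<and> w \<cdot> z = b)"
    "\<forall>W. \<forall>w\<in>Hom A P W. w \<cdot> x = Zero A X W \<and> w \<cdot> z = Zero A Z W \<longrightarrow> w = Zero A P W"
    "\<forall>W. \<forall>w\<in>Hom A W X. x \<cdot> w = Zero A W P \<longrightarrow>
       (\<exists>u\<in>Hom A W K. w = k \<cdot> u \<and> g \<cdot> u = Zero A W Z)"
proof -
  note K = Hom_objs(1)[OF k] and X = Hom_objs(2)[OF k] and Z = Hom_objs(2)[OF g]
  obtain B i j p q where bip: "biproduct A X Z B i j p q" using biproduct_exists[OF X Z] by blast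
  have i: "i \<in> Hom A X B" and j: "j \<in> Hom A Z B" and p: "p \<in> Hom A B X" and q: "q \<in> Hom A B Z"
    and B: "B \<in> Obj A"
    and pi: "p \<cdot> i = Ide A X" and qj: "q \<cdot> j = Ide A Z" and pj: "p \<cdot> j = Zero A Z X"
    and qi: "q \<cdot> i = Zero A X Z" and sum: "(i \<cdot> p) \<oplus>\<^sub>h (j \<cdot> q) = Ide A B"
    using bip by (auto simp: biproduct_def)
  obtain g' where g': "g' \<in> Hom A K Z" and neg: "Zero A K Z = g' \<oplus>\<^sub>h g"
    using differenceE[OF Zero_in_Hom[OF K Z] g] .
  define r where "r = i \<cdot> k \<oplus>\<^sub>h j \<cdot> g'"
  note ik = Comp_in_Hom[OF k i] and jg = Comp_in_Hom[OF g' j]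
  have r: "r \<in> Hom A K B" unfolding r_def by (rule Plus_in_Hom[OF ik jg])
  have pr: "p \<cdot> r = k"
    unfolding r_def
    using Comp_Plus_right[OF ik jg p] Comp_assoc[OF k i p] Comp_assoc[OF g' j p]
      Comp_Zero_left[OF g' X] Comp_Ide_left[OF k] Plus_Zero[OF k] pi pj by simp
  have qr: "q \<cdot> r = g'"
    unfolding r_def
    using Comp_Plus_right[OF ik jg q] Comp_assoc[OF k i q] Comp_assoc[OF g' j q]
      Comp_Zero_left[OF k Z] Comp_Ide_left[OF g'] Plus_Zero[OF g'] qi qj by simp
  have mr: "monic A r" using monic_of_Comp[OF r p] pr mk by simp
  obtain P c where c: "c \<in> Hom A B P" "is_cokernel A r c" using cokernelE[OF r] .
  note ker = monic_kernel_of_cokernel[OF mr r c(2)] and P = Hom_objs(2)[OF c(1)]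
  have cr: "c \<cdot> r = Zero A K P" by (rule cokernel_zero[OF c(2) r c(1)])
  define x z where "x = c \<cdot> i" and "z = c \<cdot> j"
  have x: "x \<in> Hom A X P" and z: "z \<in> Hom A Z P"
    unfolding x_def z_def by (rule Comp_in_Hom[OF i c(1)], rule Comp_in_Hom[OF j c(1)])
  note xk = Comp_in_Hom[OF k x] and zg = Comp_in_Hom[OF g z] and zg' = Comp_in_Hom[OF g' z]
  have "x \<cdot> k \<oplus>\<^sub>h z \<cdot> g' = Zero A K P"
    using cr Comp_Plus_right[OF ik jg c(1)] Comp_assoc[OF k i c(1)] Comp_assoc[OF g' j c(1)]
    by (simp add: r_def x_def z_def)
  moreover have "z \<cdot> g' \<oplus>\<^sub>h z \<cdot> g = Zero A K P"
    using Comp_Plus_right[OF g' g z] neg Comp_Zero_right[OF z K] by simp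
  moreover have "z \<cdot> g' \<oplus>\<^sub>h z \<cdot> g = z \<cdot> g \<oplus>\<^sub>h z \<cdot> g'" by (rule Plus_commute[OF zg' zg])
  ultimately have sq: "x \<cdot> k = z \<cdot> g" using Plus_cancel[OF xk zg zg'] by simp
  have mz: "monic A z"
  proof (rule monicI_zero[OF z])
    fix W h assume h: "h \<in> Hom A W Z" and 0: "z \<cdot> h = Zero A W P"
    note jh = Comp_in_Hom[OF h j] and W = Hom_objs(1)[OF h]
    have "c \<cdot> (j \<cdot> h) = Zero A W P" using 0 Comp_assoc[OF h j c(1)] by (simp add: z_def)
    then obtain u where u: "u \<in> Hom A W K" "r \<cdot> u = j \<cdot> h" using kernel_lift[OF ker c(1) r jh] by blast
    have "k \<cdot> u = p \<cdot> (j \<cdot> h)" using Comp_assoc[OF u(1) r p] pr u(2) by simp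
    also have "\<dots> = Zero A W X" by (rule Comp_zero_mid(2)[OF h j p pj])
    finally have "u = Zero A W K" using monic_cancel_zero[OF mk k u(1)] by simp
    then have "j \<cdot> h = Zero A W B" using u(2) Comp_Zero_right[OF r W] by simp
    then have "q \<cdot> (j \<cdot> h) = Zero A W Z" using Comp_Zero_right[OF q W] by simp
    then show "h = Zero A W Z" using Comp_assoc[OF h j q] qj Comp_Ide_left[OF h] by simp
  qed
  have univ: "\<exists>w\<in>Hom A P W. w \<cdot> x = a \<and> w \<cdot> z = b"
    if a: "a \<in> Hom A X W" and b: "b \<in> Hom A Z W" and eq: "a \<cdot> k = b \<cdot> g" for W a b
  proof -
    note W = Hom_objs(2)[OF a] and ap = Comp_in_Hom[OF p a] and bq = Comp_in_Hom[OF q b]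
    define h where "h = a \<cdot> p \<oplus>\<^sub>h b \<cdot> q"
    have h: "h \<in> Hom A B W" unfolding h_def by (rule Plus_in_Hom[OF ap bq])
    have hi: "h \<cdot> i = a"
      unfolding h_def
      using Comp_Plus_left[OF i ap bq] Comp_assoc[OF i p a] Comp_assoc[OF i q b] pi qi
        Comp_Ide_right[OF a] Comp_Zero_right[OF b X] Plus_Zero[OF a] by simp
    have hj: "h \<cdot> j = b"
      unfolding h_def
      using Comp_Plus_left[OF j ap bq] Comp_assoc[OF j p a] Comp_assoc[OF j q b] pj qj
        Comp_Ide_right[OF b] Comp_Zero_right[OF a Z] Plus_Zero[OF b] by simp
    note bg = Comp_in_Hom[OF g b] and bg' = Comp_in_Hom[OF g' b]
    have "h \<cdot> r = b \<cdot> g \<oplus>\<^sub>h b \<cdot> g'"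
      unfolding r_def
      using Comp_Plus_right[OF ik jg h] Comp_assoc[OF k i h] Comp_assoc[OF g' j h] hi hj eq by simp
    also have "\<dots> = b \<cdot> g' \<oplus>\<^sub>h b \<cdot> g" by (rule Plus_commute[OF bg bg'])
    also have "\<dots> = Zero A K W"
      using Comp_Plus_right[OF g' g b] neg Comp_Zero_right[OF b K] by simp
    finally obtain w where w: "w \<in> Hom A P W" "w \<cdot> c = h" using cokernel_desc[OF c(2) r c(1) h] by blast
    have "w \<cdot> x = a" "w \<cdot> z = b"
      using Comp_assoc[OF i c(1) w(1)] Comp_assoc[OF j c(1) w(1)] w(2) hi hj
      by (simp_all add: x_def z_def)
    then show ?thesis using w by blast
  qed
  have joint: "w = Zero A P W"
    if w: "w \<in> Hom A P W" and wx: "w \<cdot> x = Zero A X W" and wz: "w \<cdot> z = Zero A Z W" for W w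
  proof -
    note wc = Comp_in_Hom[OF c(1) w] and W = Hom_objs(2)[OF w]
    note ip = Comp_in_Hom[OF p i] and jq = Comp_in_Hom[OF q j]
    have "(w \<cdot> c) \<cdot> i = Zero A X W" "(w \<cdot> c) \<cdot> j = Zero A Z W"
      using wx wz Comp_assoc[OF i c(1) w] Comp_assoc[OF j c(1) w] by (simp_all add: x_def z_def)
    then have "(w \<cdot> c) \<cdot> (i \<cdot> p) = Zero A B W" "(w \<cdot> c) \<cdot> (j \<cdot> q) = Zero A B W"
      using Comp_zero_mid(2)[OF p i wc] Comp_zero_mid(2)[OF q j wc] by simp_all
    then have "(w \<cdot> c) \<cdot> Ide A B = Zero A B W"
      using Comp_Plus_right[OF ip jq wc] sum Plus_Zero[OF Zero_in_Hom[OF B W]] by simp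
    then show ?thesis
      using epic_cancel_zero[OF cokernel_epic[OF c(2)] c(1) w] Comp_Ide_right[OF wc] by simp
  qed
  have kerx: "\<exists>u\<in>Hom A W K. w = k \<cdot> u \<and> g \<cdot> u = Zero A W Z"
    if w: "w \<in> Hom A W X" and 0: "x \<cdot> w = Zero A W P" for W w
  proof -
    note iw = Comp_in_Hom[OF w i] and W = Hom_objs(1)[OF w]
    have "c \<cdot> (i \<cdot> w) = Zero A W P" using 0 Comp_assoc[OF w i c(1)] by (simp add: x_def)
    then obtain u where u: "u \<in> Hom A W K" "r \<cdot> u = i \<cdot> w" using kernel_lift[OF ker c(1) r iw] by blast
    have "k \<cdot> u = p \<cdot> (i \<cdot> w)" using Comp_assoc[OF u(1) r p] pr u(2) by simp
    then have ku: "k \<cdot> u = w" using Comp_assoc[OF w i p] pi Comp_Ide_left[OF w] by simp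
    have "g' \<cdot> u = q \<cdot> (i \<cdot> w)" using Comp_assoc[OF u(1) r q] qr u(2) by simp
    then have "g' \<cdot> u = Zero A W Z" using Comp_zero_mid(2)[OF w i q qi] by simp
    moreover have "g' \<cdot> u \<oplus>\<^sub>h g \<cdot> u = Zero A W Z"
      using Comp_Plus_left[OF u(1) g' g] neg Comp_Zero_left[OF u(1) Z] by simp
    ultimately have "g \<cdot> u = Zero A W Z" using Plus_Zero[OF Comp_in_Hom[OF u(1) g]] by simp
    then show ?thesis using u(1) ku by blast
  qed
  show ?thesis by (rule that[OF x z sq mz]) (use univ joint kerx in blast)+
qed

text \<open>
  The projection \<open>q\<close> to the old right end comes from the universal property; an arrow killing \<open>z\<close>
  agrees with one through \<open>q\<close> on both legs of the pushout, hence everywhere.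
\<close>

lemma pushout_short_exactE:
  assumes se: "short_exact A k c" and k: "k \<in> Hom A K X" and c: "c \<in> Hom A X Q"
    and g: "g \<in> Hom A K Z"
  obtains P x z q where "x \<in> Hom A X P" "z \<in> Hom A Z P" "q \<in> Hom A P Q" "x \<cdot> k = z \<cdot> g"
    "short_exact A z q"
    "\<forall>W. \<forall>a\<in>Hom A X W. \<forall>b\<in>Hom A Z W. a \<cdot> k = b \<cdot> g \<longrightarrow>
       (\<exists>w\<in>Hom A P W. w \<cdot> x = a \<and> w \<cdot> z = b)"
    "\<forall>W. \<forall>w\<in>Hom A P W. w \<cdot> x = Zero A X W \<and> w \<cdot> z = Zero A Z W \<longrightarrow> w = Zero A P W"
    "\<forall>W. \<forall>w\<in>Hom A W X. x \<cdot> w = Zero A W P \<longrightarrow>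
       (\<exists>u\<in>Hom A W K. w = k \<cdot> u \<and> g \<cdot> u = Zero A W Z)"
proof -
  note ex = short_exactD[OF se]
  obtain P x z where x: "x \<in> Hom A X P" and z: "z \<in> Hom A Z P" and sq: "x \<cdot> k = z \<cdot> g"
    and mz: "monic A z"
    and univ: "\<forall>W. \<forall>a\<in>Hom A X W. \<forall>b\<in>Hom A Z W. a \<cdot> k = b \<cdot> g \<longrightarrow>
       (\<exists>w\<in>Hom A P W. w \<cdot> x = a \<and> w \<cdot> z = b)"
    and joint: "\<forall>W. \<forall>w\<in>Hom A P W. w \<cdot> x = Zero A X W \<and> w \<cdot> z = Zero A Z W \<longrightarrow> w = Zero A P W"
    and kerx: "\<forall>W. \<forall>w\<in>Hom A W X. x \<cdot> w = Zero A W P \<longrightarrow>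
       (\<exists>u\<in>Hom A W K. w = k \<cdot> u \<and> g \<cdot> u = Zero A W Z)"
    using pushoutE[OF k g ex(3)] .
  note Q = Hom_objs(2)[OF c] and Z = Hom_objs(2)[OF g]
  have "c \<cdot> k = Zero A Z Q \<cdot> g"
    using kernel_zero[OF ex(1) c k] Comp_Zero_left[OF g Q] by simp
  then obtain q where q: "q \<in> Hom A P Q" "q \<cdot> x = c" "q \<cdot> z = Zero A Z Q"
    using univ c Zero_in_Hom[OF Z Q] by blast
  have eq: "epic A q" using epic_of_Comp[OF x q(1)] q(2) ex(4) by simp
  have cok: "is_cokernel A z q"
  proof (rule is_cokernelI[OF z q(1,3) eq])
    fix W h assume h: "h \<in> Hom A P W" and 0: "h \<cdot> z = Zero A Z W"
    note hx = Comp_in_Hom[OF x h] and W = Hom_objs(2)[OF h]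
    have "(h \<cdot> x) \<cdot> k = h \<cdot> (z \<cdot> g)" using Comp_assoc[OF k x h] sq by simp
    then have "(h \<cdot> x) \<cdot> k = Zero A K W" using Comp_zero_mid(2)[OF g z h 0] by simp
    then obtain u where u: "u \<in> Hom A Q W" "u \<cdot> c = h \<cdot> x" using cokernel_desc[OF ex(2) k c hx] by blast
    obtain d where d: "d \<in> Hom A P W" "h = d \<oplus>\<^sub>h u \<cdot> q"
      using differenceE[OF h Comp_in_Hom[OF q(1) u(1)]] .
    note uq = Comp_in_Hom[OF q(1) u(1)]
    have "h \<cdot> x = d \<cdot> x \<oplus>\<^sub>h h \<cdot> x"
      using Comp_Plus_left[OF x d(1) uq] d(2) Comp_assoc[OF x q(1) u(1)] q(2) u(2) by simp
    then have dx: "d \<cdot> x = Zero A X W"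
      using Plus_cancel[OF Comp_in_Hom[OF x d(1)] _ hx] Plus_Zero[OF hx]
        Zero_in_Hom[OF Hom_objs[OF hx]] by simp
    have "Zero A Z W = d \<cdot> z \<oplus>\<^sub>h Zero A Z W"
      using Comp_Plus_left[OF z d(1) uq] d(2) 0 Comp_assoc[OF z q(1) u(1)] q(3)
        Comp_Zero_right[OF u(1) Z] by simp
    then have dz: "d \<cdot> z = Zero A Z W" using Plus_Zero[OF Comp_in_Hom[OF z d(1)]] by simp
    have "h = u \<cdot> q" using d(2) bspec[OF spec[OF joint] d(1)] dx dz Plus_Zero[OF uq] by simp
    then show "\<exists>u\<in>Hom A Q W. u \<cdot> q = h" using u(1) by blast
  qed
  have "short_exact A z q"
    unfolding short_exact_def using cok monic_kernel_of_cokernel[OF mz z cok] by blast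
  from that[OF x z q(1) sq this univ joint kerx] show ?thesis .
qed

end


section \<open>Length of objects\<close>

inductive (in preadditive_category) series_length :: "'o \<Rightarrow> nat \<Rightarrow> bool" where
  zero: "zero_object A X \<Longrightarrow> series_length X 0"
| step: "\<lbrakk>series_length Y n; u \<in> Hom A Y X; monic A u; is_cokernel A u c; simple_object A (Cod A c)\<rbrakk>
    \<Longrightarrow> series_length X (Suc n)"

text \<open>
  A composition series of \<open>X\<close> induces series of its subobjects and quotients that are no longer than
  it, and taking the minimum turns this into strict inequalities between lengths.
\<close>

definition (in preadditive_category) len :: "'o \<Rightarrow> nat" where
  "len X = (LEAST n. series_length X n)"

context abelian_category
begin

lemma simple_target:
  assumes "simple_object A S" and f: "f \<in> Hom A X S"
  shows "f = Zero A X S \<or> epic A f"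
proof -
  obtain I e m where em: "e \<in> Hom A X I" "epic A e" "m \<in> Hom A I S" "monic A m" "f = m \<cdot> e"
    using image_factorization[OF f] .
  have "zero_object A I \<or> iso_arrow A m"
    using assms(1) em(4) HomD[OF em(3)] unfolding simple_object_def by metis
  then show ?thesis
  proof
    assume "zero_object A I"
    then have "m = Zero A I S" using zero_object_Hom(1)[OF _ em(3)] by simp
    then show ?thesis using em(5) Comp_Zero_left[OF em(1) Hom_objs(2)[OF f]] by simp
  next
    assume "iso_arrow A m"
    then show ?thesis using epic_Comp[OF em(1,3,2) iso_arrow_epic] em(5) by simp
  qed
qed

lemma simple_quotient:
  assumes "simple_object A S" and e: "e \<in> Hom A S Q" "epic A e"
  shows "zero_object A Q \<or> iso_arrow A e"
proof -
  obtain K k where k: "k \<in> Hom A K S" "is_kernel A e k" using kernelE[OF e(1)] .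
  have "zero_object A K \<or> iso_arrow A k"
    using assms(1) kernel_monic[OF k(2)] HomD[OF k(1)] unfolding simple_object_def by metis
  then show ?thesis
  proof
    assume "zero_object A K"
    then show ?thesis
      using monic_epic_iso[OF kernel_zero_monic[OF e(1) k(2)] e(2,1)] HomD[OF k(1)] by simp
  next
    assume "iso_arrow A k"
    then have "e = Zero A S Q"
      using epic_cancel_zero[OF iso_arrow_epic k(1) e(1) kernel_zero[OF k(2) e(1) k(1)]] by simp
    then show ?thesis using epic_Zero_object e(2) Hom_objs[OF e(1)] by simp
  qed
qed

lemma simple_object_iso:
  assumes S: "simple_object A S" and iso: "iso_arrow A s" and s: "s \<in> Hom A S D"
  shows "simple_object A D"
proof -
  obtain t where t: "t \<in> Hom A D S" "t \<cdot> s = Ide A S" "s \<cdot> t = Ide A D"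
    using iso_arrowE[OF iso s] .
  have mt: "monic A t" by (rule iso_arrow_monic[OF iso_arrowI[OF t(1) s t(3,2)]])
  have "iso_arrow A m" if m: "monic A m" "m \<in> Hom A W D" and W: "\<not> zero_object A W" for m W
  proof -
    note tm = Comp_in_Hom[OF m(2) t(1)]
    have "epic A (t \<cdot> m)"
      using S HomD[OF tm] W iso_arrow_epic monic_Comp[OF m(2) t(1) m(1) mt]
      unfolding simple_object_def by metis
    then have "epic A (s \<cdot> (t \<cdot> m))" using epic_Comp[OF tm s] iso_arrow_epic[OF iso] by simp
    then have "epic A m" using Comp_assoc[OF m(2) t(1) s] t(3) Comp_Ide_left[OF m(2)] by simp
    then show ?thesis using monic_epic_iso m by blast
  qed
  moreover have "\<not> zero_object A D"
    using zero_object_monic[OF iso_arrow_monic[OF iso] s] S by (auto simp: simple_object_def)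
  moreover have "m \<in> Hom A (Dom A m) D" if "monic A m" "Cod A m = D" for m
    using that by (simp add: monic_def Hom_def)
  ultimately show ?thesis using Hom_objs(2)[OF s] unfolding simple_object_def by blast
qed

text \<open>
  Intersect the series of \<open>X\<close> with the subobject: each step either disappears or keeps its simple
  factor. If none disappears, then the subobject contains every member of the series.
\<close>

lemma series_length_subobject:
  assumes "series_length X n" "monic A m" "m \<in> Hom A Z X"
  shows "\<exists>k\<le>n. series_length Z k \<and> (k = n \<longrightarrow> iso_arrow A m)"
  using assms
proof (induction arbitrary: m Z rule: series_length.induct)
  case (zero X)
  have "epic A m"
    using epicI_zero[OF zero.prems(2)] zero_object_Hom(1)[OF zero.hyps] by blast
  then have "iso_arrow A m" using monic_epic_iso[OF zero.prems(1) _ zero.prems(2)] by blast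
  then show ?case
    using series_length.zero[OF zero_object_monic[OF zero.prems zero.hyps]] by blast
next
  case (step Y n u X c)
  note u = step.hyps(2) and mm = step.prems(1) and m = step.prems(2)
  define S where "S = Cod A c"
  have c: "c \<in> Hom A X S" unfolding S_def by (rule cokernel_Hom[OF step.hyps(4) u])
  note ker = monic_kernel_of_cokernel[OF step.hyps(3) u step.hyps(4)]
  note cm = Comp_in_Hom[OF m c]
  have "c \<cdot> m = Zero A Z S \<or> epic A (c \<cdot> m)"
    using simple_target[OF _ cm] step.hyps(5) by (simp add: S_def)
  then show ?case
  proof
    assume "c \<cdot> m = Zero A Z S"
    then obtain t where t: "t \<in> Hom A Z Y" "u \<cdot> t = m" using kernel_lift[OF ker c u m] by blast
    have "monic A t" using monic_of_Comp[OF t(1) u] t(2) mm by simp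
    then obtain k where "k \<le> n" "series_length Z k" using step.IH[OF _ t(1)] by blast
    then show ?thesis by (intro exI[of _ k]) simp
  next
    assume ep: "epic A (c \<cdot> m)"
    obtain Z' z where z: "z \<in> Hom A Z' Z" "is_kernel A (c \<cdot> m) z" using kernelE[OF cm] .
    note mz = Comp_in_Hom[OF z(1) m]
    have "c \<cdot> (m \<cdot> z) = Zero A Z' S"
      using kernel_zero[OF z(2) cm z(1)] Comp_assoc[OF z(1) m c] by simp
    then obtain t where t: "t \<in> Hom A Z' Y" "u \<cdot> t = m \<cdot> z" using kernel_lift[OF ker c u mz] by blast
    have "monic A (u \<cdot> t)" using monic_Comp[OF z(1) m kernel_monic[OF z(2)] mm] t(2) by simp
    then have "monic A t" by (rule monic_of_Comp[OF t(1) u])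
    then obtain k where k: "k \<le> n" "series_length Z' k" "k = n \<longrightarrow> iso_arrow A t"
      using step.IH[OF _ t(1)] by blast
    have "series_length Z (Suc k)"
      using series_length.step[OF k(2) z(1) kernel_monic[OF z(2)]
          epic_cokernel_of_kernel[OF ep cm z(2)]] step.hyps(5) HomD[OF cm] by (simp add: S_def)
    moreover have "iso_arrow A m" if "k = n"
    proof (rule monic_epic_iso[OF mm epicI_zero[OF m] m])
      fix W g assume g: "g \<in> Hom A X W" and 0: "g \<cdot> m = Zero A Z W"
      note gu = Comp_in_Hom[OF u g]
      have "(g \<cdot> u) \<cdot> t = (g \<cdot> m) \<cdot> z"
        using Comp_assoc[OF t(1) u g] Comp_assoc[OF z(1) m g] t(2) by simp
      then have "(g \<cdot> u) \<cdot> t = Zero A Z' W" using 0 Comp_Zero_left[OF z(1) Hom_objs(2)[OF g]] by simp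
      then have "g \<cdot> u = Zero A Y W"
        using epic_cancel_zero[OF iso_arrow_epic t(1) gu] k(3) that by simp
      then obtain g' where g': "g' \<in> Hom A S W" "g' \<cdot> c = g"
        using cokernel_desc[OF step.hyps(4) u c g] by blast
      have "g' \<cdot> (c \<cdot> m) = Zero A Z W" using Comp_assoc[OF m c g'(1)] g'(2) 0 by simp
      then have "g' = Zero A S W" by (rule epic_cancel_zero[OF ep cm g'(1)])
      then show "g = Zero A X W" using g'(2) Comp_Zero_left[OF c Hom_objs(2)[OF g]] by simp
    qed
    ultimately show ?thesis using k(1) by (intro exI[of _ "Suc k"]) simp
  qed
qed

text \<open>
  Dually, take the image of the series in the quotient. A step whose factor survives has that factor
  again; if none is lost, then the kernel meets every member of the series in zero.
\<close>

lemma series_length_quotient: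
  assumes "series_length X n" "epic A p" "p \<in> Hom A X Q"
  shows "\<exists>k\<le>n. series_length Q k \<and> (k = n \<longrightarrow> iso_arrow A p)"
  using assms
proof (induction arbitrary: p Q rule: series_length.induct)
  case (zero X)
  have "monic A p"
    using monicI_zero[OF zero.prems(2)] zero_object_Hom(2)[OF zero.hyps] by blast
  then have "iso_arrow A p" using monic_epic_iso[OF _ zero.prems] by blast
  then show ?case
    using series_length.zero[OF zero_object_epic[OF zero.prems zero.hyps]] by blast
next
  case (step Y n u X c)
  note u = step.hyps(2) and ep = step.prems(1) and p = step.prems(2)
  define S where "S = Cod A c"
  have c: "c \<in> Hom A X S" unfolding S_def by (rule cokernel_Hom[OF step.hyps(4) u])
  note ker = monic_kernel_of_cokernel[OF step.hyps(3) u step.hyps(4)]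
  note pu = Comp_in_Hom[OF u p]
  obtain I p' i where im: "p' \<in> Hom A Y I" "epic A p'" "i \<in> Hom A I Q" "monic A i" "p \<cdot> u = i \<cdot> p'"
    using image_factorization[OF pu] .
  obtain k where k: "k \<le> n" "series_length I k" "k = n \<longrightarrow> iso_arrow A p'"
    using step.IH[OF im(2,1)] by blast
  obtain D q where q: "q \<in> Hom A Q D" "is_cokernel A (p \<cdot> u) q" using cokernelE[OF pu] .
  have qi: "is_cokernel A i q" using q(2) im(5) cokernel_of_epic_Comp[OF im(1-3)] by simp
  have "(q \<cdot> p) \<cdot> u = Zero A Y D"
    using cokernel_zero[OF q(2) pu q(1)] Comp_assoc[OF u p q(1)] by simp
  then obtain s where s: "s \<in> Hom A S D" "s \<cdot> c = q \<cdot> p"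
    using cokernel_desc[OF step.hyps(4) u c Comp_in_Hom[OF p q(1)]] by blast
  have "epic A (s \<cdot> c)" using epic_Comp[OF p q(1) ep cokernel_epic[OF q(2)]] s(2) by simp
  then have "epic A s" by (rule epic_of_Comp[OF c s(1)])
  then have "zero_object A D \<or> iso_arrow A s"
    using simple_quotient[OF _ s(1)] step.hyps(5) by (simp add: S_def)
  then show ?case
  proof
    assume "zero_object A D"
    then have "epic A (p \<cdot> u)" using cokernel_zero_epic[OF pu q(2)] HomD[OF q(1)] by simp
    then obtain k where "k \<le> n" "series_length Q k" using step.IH[OF _ pu] by blast
    then show ?thesis by (intro exI[of _ k]) simp
  next
    assume iso: "iso_arrow A s"
    have "simple_object A D" using simple_object_iso[OF _ iso s(1)] step.hyps(5) by (simp add: S_def)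
    then have "series_length Q (Suc k)"
      using series_length.step[OF k(2) im(3,4) qi] HomD[OF q(1)] by simp
    moreover have "iso_arrow A p" if "k = n"
    proof (rule monic_epic_iso[OF monicI_zero[OF p] ep p])
      fix W g assume g: "g \<in> Hom A W X" and 0: "p \<cdot> g = Zero A W Q"
      note cg = Comp_in_Hom[OF g c] and W = Hom_objs(1)[OF g]
      have "s \<cdot> (c \<cdot> g) = q \<cdot> (p \<cdot> g)"
        using Comp_assoc[OF g c s(1)] Comp_assoc[OF g p q(1)] s(2) by simp
      then have "s \<cdot> (c \<cdot> g) = Zero A W D" using 0 Comp_Zero_right[OF q(1) W] by simp
      then have "c \<cdot> g = Zero A W S" by (rule monic_cancel_zero[OF iso_arrow_monic[OF iso] s(1) cg])
      then obtain h where h: "h \<in> Hom A W Y" "u \<cdot> h = g" using kernel_lift[OF ker c u g] by blast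
      have mp: "monic A (p \<cdot> u)"
        using monic_Comp[OF im(1,3) iso_arrow_monic im(4)] k(3) that im(5) by simp
      have "(p \<cdot> u) \<cdot> h = Zero A W Q" using Comp_assoc[OF h(1) u p] h(2) 0 by simp
      then have "h = Zero A W Y" by (rule monic_cancel_zero[OF mp pu h(1)])
      then show "g = Zero A W X" using h(2) Comp_Zero_right[OF u W] by simp
    qed
    ultimately show ?thesis using k(1) by (intro exI[of _ "Suc k"]) simp
  qed
qed

end

context abelian_length_category
begin

lemma series_length_exists:
  assumes "X \<in> Obj A"
  shows "\<exists>n. series_length X n"
proof -
  obtain n Y u where Y: "zero_object A (Y 0)" "Y n = X"
    and u: "\<And>i. i < n \<Longrightarrow> u i \<in> Hom A (Y i) (Y (Suc i)) \<and> monic A (u i) \<and>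
      (\<exists>c. is_cokernel A (u i) c \<and> simple_object A (Cod A c))"
    using finite_length[OF assms] unfolding finite_length_def by blast
  have "series_length (Y i) i" if "i \<le> n" for i
    using that
  proof (induction i)
    case 0
    show ?case by (rule series_length.zero[OF Y(1)])
  next
    case (Suc i)
    then show ?case using series_length.step u[of i] by (metis Suc_le_lessD Suc_leD)
  qed
  then show ?thesis using Y(2) by blast
qed

lemma series_length_len: "X \<in> Obj A \<Longrightarrow> series_length X (len X)"
  unfolding len_def using series_length_exists by (metis LeastI)

lemma len_subobject_less:
  assumes "monic A m" "m \<in> Hom A Z X" "\<not> iso_arrow A m"
  shows "len Z < len X"
proof -
  obtain k where k: "k \<le> len X" "series_length Z k" "k = len X \<longrightarrow> iso_arrow A m"
    using series_length_subobject[OF series_length_len assms(1,2)] Hom_objs[OF assms(2)] by blast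
  have "len Z \<le> k" unfolding len_def by (rule Least_le) (rule k(2))
  then show ?thesis using k assms(3) by linarith
qed

lemma len_quotient_less:
  assumes "epic A p" "p \<in> Hom A X Q" "\<not> iso_arrow A p"
  shows "len Q < len X"
proof -
  obtain k where k: "k \<le> len X" "series_length Q k" "k = len X \<longrightarrow> iso_arrow A p"
    using series_length_quotient[OF series_length_len assms(1,2)] Hom_objs[OF assms(2)] by blast
  have "len Q \<le> k" unfolding len_def by (rule Least_le) (rule k(2))
  then show ?thesis using k assms(3) by linarith
qed

end


section \<open>Torsion classes and torsionfree objects\<close>

context abelian_category
begin

lemma subcategory_zero:
  assumes "subcategory A C" "zero_object A X"
  shows "X \<in> C"
  using assms zero_objects_isomorphic unfolding subcategory_def by blast

lemma torsion_class_Obj: "torsion_class A T \<Longrightarrow> T \<subseteq> Obj A"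
  by (simp add: torsion_class_def subcategory_def)

lemma torsion_class_zero: "\<lbrakk>torsion_class A T; zero_object A X\<rbrakk> \<Longrightarrow> X \<in> T"
  by (simp add: torsion_class_def subcategory_zero)

lemma torsion_class_quotient:
  "\<lbrakk>torsion_class A T; e \<in> Hom A X Y; epic A e; X \<in> T\<rbrakk> \<Longrightarrow> Y \<in> T"
  unfolding torsion_class_def quotient_closed_def by (metis HomD)

lemma extension_closedD:
  "\<lbrakk>extension_closed A C; short_exact A f g; f \<in> Hom A X Y; g \<in> Hom A Y Z; X \<in> C; Z \<in> C\<rbrakk> \<Longrightarrow> Y \<in> C"
  unfolding extension_closed_def by (metis HomD)

lemma extension_closedI:
  assumes "\<And>X Y Z f g. \<lbrakk>short_exact A f g; f \<in> Hom A X Y; g \<in> Hom A Y Z; X \<in> C; Z \<in> C\<rbrakk> \<Longrightarrow> Y \<in> C"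
  shows "extension_closed A C"
  unfolding extension_closed_def
proof (intro allI impI)
  fix f g assume *: "short_exact A f g \<and> Dom A f \<in> C \<and> Cod A g \<in> C"
  then have f: "f \<in> Hom A (Dom A f) (Cod A f)" and g: "g \<in> Hom A (Cod A f) (Cod A g)"
    by (auto simp: short_exact_def is_cokernel_def Hom_def)
  show "Cod A f \<in> C" by (rule assms[OF _ f g]) (use * in auto)
qed

lemma torsion_class_extension:
  "\<lbrakk>torsion_class A T; short_exact A f g; f \<in> Hom A X Y; g \<in> Hom A Y Z; X \<in> T; Z \<in> T\<rbrakk> \<Longrightarrow> Y \<in> T"
  unfolding torsion_class_def using extension_closedD by blast

lemma torsion_classI:
  assumes "T \<subseteq> Obj A" "\<And>X. zero_object A X \<Longrightarrow> X \<in> T"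
    and ext: "\<And>X Y Z f g. \<lbrakk>short_exact A f g; f \<in> Hom A X Y; g \<in> Hom A Y Z; X \<in> T; Z \<in> T\<rbrakk> \<Longrightarrow> Y \<in> T"
    and quot: "\<And>X Y e. \<lbrakk>e \<in> Hom A X Y; epic A e; X \<in> T\<rbrakk> \<Longrightarrow> Y \<in> T"
  shows "torsion_class A T"
proof -
  have "subcategory A T"
    unfolding subcategory_def isomorphic_def
    using assms(1,2) zero_object_exists quot iso_arrow_epic by blast
  moreover have "quotient_closed A T"
    unfolding quotient_closed_def using quot Arr_in_Hom by (metis epic_def)
  ultimately show ?thesis unfolding torsion_class_def using extension_closedI[of T] ext by blast
qed

lemma torsion_class_Inter:
  assumes "\<T> \<noteq> {}" "\<And>T. T \<in> \<T> \<Longrightarrow> torsion_class A T"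
  shows "torsion_class A (\<Inter>\<T>)"
proof (rule torsion_classI)
  show "\<Inter>\<T> \<subseteq> Obj A" using assms torsion_class_Obj by blast
  show "X \<in> \<Inter>\<T>" if "zero_object A X" for X using that assms(2) torsion_class_zero by blast
  show "Y \<in> \<Inter>\<T>" if "short_exact A f g" "f \<in> Hom A X Y" "g \<in> Hom A Y Z" "X \<in> \<Inter>\<T>" "Z \<in> \<Inter>\<T>"
    for X Y Z f g using that assms(2) torsion_class_extension by blast
  show "Y \<in> \<Inter>\<T>" if "e \<in> Hom A X Y" "epic A e" "X \<in> \<Inter>\<T>" for X Y e
    using that assms(2) torsion_class_quotient by blast
qed

lemma torsion_class_Int:
  "\<lbrakk>torsion_class A T; torsion_class A T'\<rbrakk> \<Longrightarrow> torsion_class A (T \<inter> T')"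
  using torsion_class_Inter[of "{T, T'}"] by auto

lemma torsion_class_all: "torsion_class A (Obj A)"
  by (rule torsion_classI) (auto simp: zero_object_def dest: Hom_objs)

definition left_perp :: "'o set \<Rightarrow> 'o set" where
  "left_perp C = {X \<in> Obj A. \<forall>M\<in>C. \<forall>f\<in>Hom A X M. f = Zero A X M}"

lemma torsion_class_left_perp: "torsion_class A (left_perp C)"
proof (rule torsion_classI)
  show "left_perp C \<subseteq> Obj A" by (auto simp: left_perp_def)
  show "X \<in> left_perp C" if "zero_object A X" for X
    using that zero_object_Hom(1)[OF that] by (auto simp: left_perp_def zero_object_iff)
next
  fix X Y Z f g
  assume se: "short_exact A f g" and f: "f \<in> Hom A X Y" and g: "g \<in> Hom A Y Z"
    and XZ: "X \<in> left_perp C" "Z \<in> left_perp C"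
  have "h = Zero A Y M" if M: "M \<in> C" and h: "h \<in> Hom A Y M" for M h
  proof -
    have "h \<cdot> f = Zero A X M" using XZ(1) Comp_in_Hom[OF f h] M by (simp add: left_perp_def)
    then obtain t where t: "t \<in> Hom A Z M" "t \<cdot> g = h"
      using cokernel_desc[OF short_exactD(2)[OF se] f g h] by blast
    have "t = Zero A Z M" using XZ(2) t(1) M by (simp add: left_perp_def)
    then show ?thesis using t(2) Comp_Zero_left[OF g Hom_objs(2)[OF h]] by simp
  qed
  then show "Y \<in> left_perp C" using Hom_objs(1)[OF g] by (simp add: left_perp_def)
next
  fix X Y e assume e: "e \<in> Hom A X Y" "epic A e" and X: "X \<in> left_perp C"
  have "h = Zero A Y M" if M: "M \<in> C" and h: "h \<in> Hom A Y M" for M h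
  proof -
    have "h \<cdot> e = Zero A X M" using X Comp_in_Hom[OF e(1) h] M by (simp add: left_perp_def)
    then show ?thesis by (rule epic_cancel_zero[OF e(2,1) h])
  qed
  then show "Y \<in> left_perp C" using Hom_objs(2)[OF e(1)] by (simp add: left_perp_def)
qed

lemma right_perpI:
  assumes "U \<subseteq> Obj A" "Y \<in> Obj A" "\<And>V h. \<lbrakk>V \<in> U; h \<in> Hom A V Y\<rbrakk> \<Longrightarrow> h = Zero A V Y"
  shows "Y \<in> right_perp A U"
  using assms Zero_in_Hom unfolding right_perp_def by blast

lemma right_perp_Obj: "Y \<in> right_perp A U \<Longrightarrow> Y \<in> Obj A"
  by (simp add: right_perp_def)

lemma right_perpD: "\<lbrakk>Y \<in> right_perp A U; V \<in> U; h \<in> Hom A V Y\<rbrakk> \<Longrightarrow> h = Zero A V Y"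
  unfolding right_perp_def by blast

lemma right_perp_antimono: "U \<subseteq> U' \<Longrightarrow> right_perp A U' \<subseteq> right_perp A U"
  unfolding right_perp_def by blast

lemma right_perp_zero:
  assumes "U \<subseteq> Obj A" "zero_object A X"
  shows "X \<in> right_perp A U"
  using right_perpI[OF assms(1)] zero_object_Hom(2)[OF assms(2)] assms(2) zero_object_iff by blast

lemma right_perp_subobject:
  assumes "U \<subseteq> Obj A" and m: "m \<in> Hom A X Y" "monic A m" and Y: "Y \<in> right_perp A U"
  shows "X \<in> right_perp A U"
proof (rule right_perpI[OF assms(1) Hom_objs(1)[OF m(1)]])
  fix V h assume "V \<in> U" and h: "h \<in> Hom A V X"
  then have "m \<cdot> h = Zero A V Y" using right_perpD[OF Y _ Comp_in_Hom[OF h m(1)]] by simp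
  then show "h = Zero A V X" by (rule monic_cancel_zero[OF m(2,1) h])
qed

lemma right_perp_extension:
  assumes "U \<subseteq> Obj A" and se: "short_exact A f g" and f: "f \<in> Hom A X Y" and g: "g \<in> Hom A Y Z"
    and X: "X \<in> right_perp A U" and Z: "Z \<in> right_perp A U"
  shows "Y \<in> right_perp A U"
proof (rule right_perpI[OF assms(1) Hom_objs(1)[OF g]])
  fix V h assume V: "V \<in> U" and h: "h \<in> Hom A V Y"
  then have "g \<cdot> h = Zero A V Z" using right_perpD[OF Z _ Comp_in_Hom[OF h g]] by simp
  then obtain t where t: "t \<in> Hom A V X" "f \<cdot> t = h"
    using kernel_lift[OF short_exactD(1)[OF se] g f h] by blast
  then show "h = Zero A V Y"
    using right_perpD[OF X V t(1)] Comp_Zero_right[OF f Hom_objs(1)[OF h]] by simp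
qed

lemma torsion_torsionfree_zero:
  assumes "X \<in> U" "X \<in> right_perp A U"
  shows "zero_object A X"
  using right_perpD[OF assms(2,1) Ide_in_Hom] right_perp_Obj[OF assms(2)] zero_object_iff by blast

lemma right_perp_iso:
  assumes "U \<subseteq> Obj A" "isomorphic A X Y" "X \<in> right_perp A U"
  shows "Y \<in> right_perp A U"
proof -
  obtain f where f: "f \<in> Hom A Y X" "iso_arrow A f"
    using isomorphic_sym[OF assms(2)] by (auto simp: isomorphic_def)
  show ?thesis by (rule right_perp_subobject[OF assms(1) f(1) iso_arrow_monic[OF f(2)] assms(3)])
qed

text \<open>
  The basic construction behind everything about cokernels: if \<open>f : X \<rightarrow> Y\<close> has torsionfree target
  but a cokernel that is not torsionfree, pull the projection \<open>Y \<rightarrow> coker f\<close> back along a nonzero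
  torsion subobject \<open>V\<close> of the cokernel. The pullback \<open>E\<close> is torsionfree as a subobject of \<open>Y\<close>, and it
  lies in every torsion class containing \<open>X\<close> and \<open>V\<close> as an extension of \<open>V\<close> by the image \<open>I\<close> of \<open>f\<close>.
\<close>

lemma torsion_in_cokernelE:
  assumes U: "torsion_class A U"
    and T: "torsion_class A T" "U \<subseteq> T" "X \<in> T" and Y: "Y \<in> right_perp A U"
    and f: "f \<in> Hom A X Y" and c: "is_cokernel A f c" "Cod A c \<notin> right_perp A U"
  obtains I E V e i p where "e \<in> Hom A X I" "epic A e" "i \<in> Hom A I E" "p \<in> Hom A E V"
    "short_exact A i p" "I \<in> heart A U T" "E \<in> heart A U T" "V \<in> U" "\<not> zero_object A V"
proof -
  note UO = torsion_class_Obj[OF U]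
  define C where "C = Cod A c"
  have cH: "c \<in> Hom A Y C" unfolding C_def by (rule cokernel_Hom[OF c(1) f])
  obtain I e m where em: "e \<in> Hom A X I" "epic A e" "m \<in> Hom A I Y" "monic A m" "f = m \<cdot> e"
    using image_factorization[OF f] .
  have cm: "is_cokernel A m c" using c(1) em(5) cokernel_of_epic_Comp[OF em(1-3)] by simp
  note km = monic_kernel_of_cokernel[OF em(4,3) cm]
  \<comment> \<open>\<open>C\<close> receives a nonzero arrow from a torsion object; its image \<open>V\<close> is torsion again\<close>
  obtain V0 h where V0: "V0 \<in> U" and h: "h \<in> Hom A V0 C" "h \<noteq> Zero A V0 C"
    using right_perpI[OF UO Hom_objs(2)[OF cH]] c(2) by (auto simp: C_def)
  obtain V h' v where v: "h' \<in> Hom A V0 V" "epic A h'" "v \<in> Hom A V C" "monic A v" "h = v \<cdot> h'"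
    using image_factorization[OF h(1)] .
  have VU: "V \<in> U" by (rule torsion_class_quotient[OF U v(1,2) V0])
  have Vn: "\<not> zero_object A V"
  proof
    assume "zero_object A V"
    then have "h' = Zero A V0 V" using zero_object_Hom(2) v(1) by blast
    then show False using h(2) v(5) Comp_Zero_right[OF v(3) Hom_objs(1)[OF h(1)]] by simp
  qed
  \<comment> \<open>the pullback \<open>E\<close> is the kernel of \<open>Y \<rightarrow> C \<rightarrow> C / V\<close>\<close>
  obtain D d where d: "d \<in> Hom A C D" "is_cokernel A v d" using cokernelE[OF v(3)] .
  note kv = monic_kernel_of_cokernel[OF v(4,3) d(2)] and dc = Comp_in_Hom[OF cH d(1)]
  obtain E y where y: "y \<in> Hom A E Y" "is_kernel A (d \<cdot> c) y" using kernelE[OF dc] .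
  note my = kernel_monic[OF y(2)] and cy = Comp_in_Hom[OF y(1) cH]
  have "d \<cdot> (c \<cdot> y) = Zero A E D"
    using kernel_zero[OF y(2) dc y(1)] Comp_assoc[OF y(1) cH d(1)] by simp
  then obtain p where p: "p \<in> Hom A E V" "v \<cdot> p = c \<cdot> y" using kernel_lift[OF kv d(1) v(3) cy] by blast
  have edc: "epic A (d \<cdot> c)" by (rule epic_Comp[OF cH d(1) cokernel_epic[OF c(1)] cokernel_epic[OF d(2)]])
  \<comment> \<open>\<open>d \<cdot> c\<close> is the cokernel of \<open>y\<close>, so the image of \<open>p\<close> cannot be smaller than \<open>V\<close>\<close>
  note cky = epic_cokernel_of_kernel[OF edc dc y(2)]
  have ep: "epic A p"
  proof -
    obtain V1 p1 n where n: "p1 \<in> Hom A E V1" "epic A p1" "n \<in> Hom A V1 V" "monic A n" "p = n \<cdot> p1"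
      using image_factorization[OF p(1)] .
    note vn = Comp_in_Hom[OF n(3) v(3)] and mvn = monic_Comp[OF n(3) v(3) n(4) v(4)]
    obtain D1 d1 where d1: "d1 \<in> Hom A C D1" "is_cokernel A (v \<cdot> n) d1" using cokernelE[OF vn] .
    have "(d1 \<cdot> c) \<cdot> y = d1 \<cdot> ((v \<cdot> n) \<cdot> p1)"
      using Comp_assoc[OF y(1) cH d1(1)] p(2) n(5) Comp_assoc[OF n(1,3) v(3)] by simp
    also have "\<dots> = Zero A E D1"
      using Comp_zero_mid(2)[OF n(1) vn d1(1) cokernel_zero[OF d1(2) vn d1(1)]] .
    finally obtain s where s: "s \<in> Hom A D D1" "s \<cdot> (d \<cdot> c) = d1 \<cdot> c"
      using cokernel_desc[OF cky y(1) dc Comp_in_Hom[OF cH d1(1)]] by blast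
    have "(s \<cdot> d) \<cdot> c = d1 \<cdot> c" using s(2) Comp_assoc[OF cH d(1) s(1)] by simp
    then have sd: "s \<cdot> d = d1"
      using epic_cancel[OF cokernel_epic[OF c(1)] cH Comp_in_Hom[OF d(1) s(1)] d1(1)] by simp
    have "d1 \<cdot> v = Zero A V D1"
      using Comp_zero_mid(1)[OF v(3) d(1) s(1) cokernel_zero[OF d(2) v(3) d(1)]] sd by simp
    then obtain t where t: "t \<in> Hom A V V1" "(v \<cdot> n) \<cdot> t = v"
      using kernel_lift[OF monic_kernel_of_cokernel[OF mvn vn d1(2)] d1(1) vn v(3)] by blast
    have "v \<cdot> (n \<cdot> t) = v \<cdot> Ide A V"
      using t(2) Comp_assoc[OF t(1) n(3) v(3)] Comp_Ide_right[OF v(3)] by simp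
    then have "n \<cdot> t = Ide A V"
      using monic_cancel[OF v(4,3) Comp_in_Hom[OF t(1) n(3)] Ide_in_Hom] Hom_objs[OF t(1)] by simp
    then have "epic A n" using epic_of_Comp[OF t(1) n(3)] Ide_epic Hom_objs[OF t(1)] by simp
    then show ?thesis using epic_Comp[OF n(1,3,2)] n(5) by simp
  qed
  have "(d \<cdot> c) \<cdot> m = Zero A I D"
    by (rule Comp_zero_mid(1)[OF em(3) cH d(1) kernel_zero[OF km cH em(3)]])
  then obtain i where i: "i \<in> Hom A I E" "y \<cdot> i = m" using kernel_lift[OF y(2) dc y(1) em(3)] by blast
  have mi: "monic A i" using monic_of_Comp[OF i(1) y(1)] i(2) em(4) by simp
  have ki: "is_kernel A p i"
  proof (rule is_kernelI[OF p(1) i(1) _ mi])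
    have "v \<cdot> (p \<cdot> i) = c \<cdot> m"
      using Comp_assoc[OF i(1) p(1) v(3)] Comp_assoc[OF i(1) y(1) cH] p(2) i(2) by simp
    then have "v \<cdot> (p \<cdot> i) = Zero A I C" using kernel_zero[OF km cH em(3)] by simp
    then show "p \<cdot> i = Zero A I V" by (rule monic_cancel_zero[OF v(4,3) Comp_in_Hom[OF i(1) p(1)]])
  next
    fix W g assume g: "g \<in> Hom A W E" and 0: "p \<cdot> g = Zero A W V"
    note yg = Comp_in_Hom[OF g y(1)]
    have "c \<cdot> (y \<cdot> g) = v \<cdot> (p \<cdot> g)"
      using Comp_assoc[OF g y(1) cH] Comp_assoc[OF g p(1) v(3)] p(2) by simp
    then have "c \<cdot> (y \<cdot> g) = Zero A W C" using 0 Comp_Zero_right[OF v(3) Hom_objs(1)[OF g]] by simp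
    then obtain u where u: "u \<in> Hom A W I" "m \<cdot> u = y \<cdot> g" using kernel_lift[OF km cH em(3) yg] by blast
    have "y \<cdot> (i \<cdot> u) = y \<cdot> g" using Comp_assoc[OF u(1) i(1) y(1)] i(2) u(2) by simp
    then have "i \<cdot> u = g" by (rule monic_cancel[OF my y(1) Comp_in_Hom[OF u(1) i(1)] g])
    then show "\<exists>u\<in>Hom A W I. i \<cdot> u = g" using u(1) by blast
  qed
  have se: "short_exact A i p"
    unfolding short_exact_def using ki epic_cokernel_of_kernel[OF ep p(1) ki] by simp
  have IT: "I \<in> T" by (rule torsion_class_quotient[OF T(1) em(1,2) T(3)])
  have "I \<in> heart A U T"
    unfolding heart_def using IT right_perp_subobject[OF UO em(3,4) Y] by simp
  moreover have "E \<in> heart A U T"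
    unfolding heart_def
    using torsion_class_extension[OF T(1) se i(1) p(1) IT] VU T(2)
      right_perp_subobject[OF UO y(1) my Y] by blast
  ultimately show ?thesis using that[OF em(1,2) i(1) p(1) se _ _ VU Vn] by blast
qed

end


section \<open>The torsion class of objects with torsionfree cokernels\<close>

text \<open>
  The intersection of this class with \<open>U\<^sup>\<bottom>\<close> consists of those torsionfree objects all of whose
  arrows to torsionfree objects have torsionfree cokernel. Not restricting the class itself to
  torsionfree objects is what makes it a torsion class.
\<close>

definition (in preadditive_category) coker_class :: "'o set \<Rightarrow> 'o set" where
  "coker_class U = {X \<in> Obj A. \<forall>Y\<in>right_perp A U. \<forall>f\<in>Hom A X Y. \<forall>c.
     is_cokernel A f c \<longrightarrow> Cod A c \<in> right_perp A U}"

context abelian_category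
begin

lemma coker_classD:
  "\<lbrakk>X \<in> coker_class U; Y \<in> right_perp A U; f \<in> Hom A X Y; is_cokernel A f c\<rbrakk>
    \<Longrightarrow> Cod A c \<in> right_perp A U"
  unfolding coker_class_def by blast

lemma coker_classI:
  assumes U: "U \<subseteq> Obj A" and X: "X \<in> Obj A"
    and *: "\<And>Y f. \<lbrakk>Y \<in> right_perp A U; f \<in> Hom A X Y\<rbrakk> \<Longrightarrow>
      \<exists>c. is_cokernel A f c \<and> Cod A c \<in> right_perp A U"
  shows "X \<in> coker_class U"
  unfolding coker_class_def using X * cokernels_isomorphic right_perp_iso[OF U] by blast

lemma torsion_class_coker_class:
  assumes U: "U \<subseteq> Obj A"
  shows "torsion_class A (coker_class U)"
proof (rule torsion_classI)
  show "coker_class U \<subseteq> Obj A" by (auto simp: coker_class_def)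
next
  fix X assume zX: "zero_object A X"
  show "X \<in> coker_class U"
  proof (rule coker_classI[OF U])
    show "X \<in> Obj A" using zX by (simp add: zero_object_iff)
    fix Y f assume Y: "Y \<in> right_perp A U" and f: "f \<in> Hom A X Y"
    note YO = Hom_objs(2)[OF f]
    have "is_cokernel A f (Ide A Y)"
    proof (rule is_cokernelI[OF f Ide_in_Hom[OF YO] _ Ide_epic[OF YO]])
      show "Ide A Y \<cdot> f = Zero A X Y" using zero_object_Hom(1)[OF zX f] Comp_Ide_left[OF f] by simp
    qed (use Comp_Ide_right in blast)
    then show "\<exists>c. is_cokernel A f c \<and> Cod A c \<in> right_perp A U"
      using Y HomD(3)[OF Ide_in_Hom[OF YO]] by auto
  qed
next
  fix X Y e assume e: "e \<in> Hom A X Y" "epic A e" and X: "X \<in> coker_class U"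
  show "Y \<in> coker_class U"
  proof (rule coker_classI[OF U Hom_objs(2)[OF e(1)]])
    fix M f assume M: "M \<in> right_perp A U" and f: "f \<in> Hom A Y M"
    obtain C c where c: "c \<in> Hom A M C" "is_cokernel A (f \<cdot> e) c"
      using cokernelE[OF Comp_in_Hom[OF e(1) f]] .
    then show "\<exists>c. is_cokernel A f c \<and> Cod A c \<in> right_perp A U"
      using coker_classD[OF X M Comp_in_Hom[OF e(1) f] c(2)] cokernel_of_epic_Comp[OF e f] by blast
  qed
next
  fix X Y Z a b
  assume se: "short_exact A a b" and a: "a \<in> Hom A X Y" and b: "b \<in> Hom A Y Z"
    and X: "X \<in> coker_class U" and Z: "Z \<in> coker_class U"
  show "Y \<in> coker_class U"
  proof (rule coker_classI[OF U Hom_objs(2)[OF a]])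
    fix M f assume M: "M \<in> right_perp A U" and f: "f \<in> Hom A Y M"
    \<comment> \<open>the cokernel of \<open>f\<close> is obtained by dividing out first \<open>X\<close>, then \<open>Z\<close>\<close>
    note fa = Comp_in_Hom[OF a f]
    obtain C c where c: "c \<in> Hom A M C" "is_cokernel A (f \<cdot> a) c" using cokernelE[OF fa] .
    note cf = Comp_in_Hom[OF f c(1)]
    have C: "C \<in> right_perp A U" using coker_classD[OF X M fa c(2)] HomD[OF c(1)] by simp
    have "(c \<cdot> f) \<cdot> a = Zero A X C"
      using cokernel_zero[OF c(2) fa c(1)] Comp_assoc[OF a f c(1)] by simp
    then obtain t where t: "t \<in> Hom A Z C" "t \<cdot> b = c \<cdot> f"
      using cokernel_desc[OF short_exactD(2)[OF se] a b cf] by blast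
    obtain D d where d: "d \<in> Hom A C D" "is_cokernel A t d" using cokernelE[OF t(1)] .
    note dc = Comp_in_Hom[OF c(1) d(1)]
    have "is_cokernel A f (d \<cdot> c)"
    proof (rule is_cokernelI[OF f dc _ epic_Comp[OF c(1) d(1) cokernel_epic[OF c(2)] cokernel_epic[OF d(2)]]])
      have "(d \<cdot> c) \<cdot> f = (d \<cdot> t) \<cdot> b"
        using Comp_assoc[OF f c(1) d(1)] Comp_assoc[OF b t(1) d(1)] t(2) by simp
      then show "(d \<cdot> c) \<cdot> f = Zero A Y D"
        using cokernel_zero[OF d(2) t(1) d(1)] Comp_Zero_left[OF b Hom_objs(2)[OF d(1)]] by simp
    next
      fix W h assume h: "h \<in> Hom A M W" and 0: "h \<cdot> f = Zero A Y W"
      have "h \<cdot> (f \<cdot> a) = Zero A X W" by (rule Comp_zero_mid(2)[OF a f h 0])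
      then obtain u where u: "u \<in> Hom A C W" "u \<cdot> c = h" using cokernel_desc[OF c(2) fa c(1) h] by blast
      have "(u \<cdot> t) \<cdot> b = Zero A Y W"
        using Comp_assoc[OF b t(1) u(1)] Comp_assoc[OF f c(1) u(1)] t(2) u(2) 0 by simp
      then have "u \<cdot> t = Zero A Z W"
        by (rule epic_cancel_zero[OF short_exactD(4)[OF se] b Comp_in_Hom[OF t(1) u(1)]])
      then obtain w where w: "w \<in> Hom A D W" "w \<cdot> d = u" using cokernel_desc[OF d(2) t(1) d(1) u(1)] by blast
      then have "w \<cdot> (d \<cdot> c) = h" using Comp_assoc[OF c(1) d(1) w(1)] u(2) by simp
      then show "\<exists>u\<in>Hom A D W. u \<cdot> (d \<cdot> c) = h" using w(1) by blast
    qed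
    moreover have "D \<in> right_perp A U" using coker_classD[OF Z C t(1) d(2)] HomD[OF d(1)] by simp
    ultimately show "\<exists>c. is_cokernel A f c \<and> Cod A c \<in> right_perp A U" using HomD[OF dc] by auto
  qed
qed

lemma torsion_subset_coker_class:
  assumes U: "torsion_class A U"
  shows "U \<subseteq> coker_class U"
proof
  fix V assume V: "V \<in> U"
  note UO = torsion_class_Obj[OF U]
  show "V \<in> coker_class U"
  proof (rule coker_classI[OF UO])
    show "V \<in> Obj A" using V UO by blast
    fix Y f assume Y: "Y \<in> right_perp A U" and f: "f \<in> Hom A V Y"
    note YO = Hom_objs(2)[OF f]
    have "is_cokernel A f (Ide A Y)"
    proof (rule is_cokernelI[OF f Ide_in_Hom[OF YO] _ Ide_epic[OF YO]])
      show "Ide A Y \<cdot> f = Zero A V Y" using right_perpD[OF Y V f] Comp_Ide_left[OF f] by simp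
    qed (use Comp_Ide_right in blast)
    then show "\<exists>c. is_cokernel A f c \<and> Cod A c \<in> right_perp A U"
      using Y HomD(3)[OF Ide_in_Hom[OF YO]] by auto
  qed
qed

lemma heart_subcategory:
  assumes U: "torsion_class A U" and T: "torsion_class A T"
  shows "subcategory A (heart A U T)"
proof -
  note UO = torsion_class_Obj[OF U]
  obtain Z where Z: "zero_object A Z" using zero_object_exists by blast
  have "Z \<in> heart A U T"
    unfolding heart_def using torsion_class_zero[OF T Z] right_perp_zero[OF UO Z] by simp
  moreover have "Y \<in> heart A U T" if X: "X \<in> heart A U T" and iso: "isomorphic A X Y" for X Y
  proof -
    have "Y \<in> right_perp A U" using right_perp_iso[OF UO iso] X by (simp add: heart_def)
    moreover obtain f where "f \<in> Hom A X Y" "iso_arrow A f" using iso by (auto simp: isomorphic_def)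
    then have "Y \<in> T" using torsion_class_quotient[OF T _ iso_arrow_epic] X by (auto simp: heart_def)
    ultimately show ?thesis by (simp add: heart_def)
  qed
  moreover have "heart A U T \<subseteq> Obj A" using torsion_class_Obj[OF T] by (auto simp: heart_def)
  ultimately show ?thesis unfolding subcategory_def using Z by blast
qed

lemma heart_extension_closed:
  assumes U: "torsion_class A U" and T: "torsion_class A T"
  shows "extension_closed A (heart A U T)"
proof (rule extension_closedI)
  fix X Y Z f g assume "short_exact A f g" "f \<in> Hom A X Y" "g \<in> Hom A Y Z"
    "X \<in> heart A U T" "Z \<in> heart A U T"
  then show "Y \<in> heart A U T"
    using torsion_class_extension[OF T] right_perp_extension[OF torsion_class_Obj[OF U]]
    unfolding heart_def by blast
qed

lemma heart_image_closed:
  assumes U: "torsion_class A U" and T: "torsion_class A T"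
  shows "image_closed A (heart A U T)"
  unfolding image_closed_def
proof (intro allI impI)
  fix f m assume *: "Dom A f \<in> heart A U T \<and> Cod A f \<in> heart A U T \<and> is_image A f m"
  then have f: "f \<in> Hom A (Dom A f) (Cod A f)"
    by (auto simp: is_image_def is_cokernel_def Hom_def)
  obtain e where "e \<in> Hom A (Dom A f) (Dom A m)" "epic A e" "m \<in> Hom A (Dom A m) (Cod A f)" "monic A m"
    using is_imageE[OF _ f] * by metis
  then show "Dom A m \<in> heart A U T"
    using * torsion_class_quotient[OF T] right_perp_subobject[OF torsion_class_Obj[OF U]]
    unfolding heart_def by blast
qed

lemma heart_cokernel_closed:
  assumes T: "torsion_class A T" and sub: "T \<subseteq> coker_class U"
  shows "cokernel_closed A (heart A U T)"
  unfolding cokernel_closed_def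
proof (intro allI impI)
  fix f c assume *: "Dom A f \<in> heart A U T \<and> Cod A f \<in> heart A U T \<and> is_cokernel A f c"
  then have f: "f \<in> Hom A (Dom A f) (Cod A f)" by (auto simp: is_cokernel_def Hom_def)
  have c: "is_cokernel A f c" using * by simp
  have "Cod A c \<in> right_perp A U"
    using coker_classD[OF _ _ f c] * sub by (auto simp: heart_def)
  moreover have "Cod A c \<in> T"
    using torsion_class_quotient[OF T cokernel_Hom[OF c f] cokernel_epic[OF c]] * by (simp add: heart_def)
  ultimately show "Cod A c \<in> heart A U T" by (simp add: heart_def)
qed

lemma tors_interval_iff:
  "tors_interval A U T \<longleftrightarrow> torsion_class A U \<and> torsion_class A T \<and> U \<subseteq> T"
  by (simp add: tors_interval_def tors_def)

text \<open>
  A torsion subobject \<open>V\<close> of a cokernel, as found by \<open>torsion_in_cokernelE\<close>, is itself a cokernel of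
  an arrow in the heart. If the heart is closed under cokernels, then \<open>V\<close> is torsionfree as well,
  hence zero.
\<close>

lemma ICE_interval_iff_subset_coker_class:
  assumes "tors_interval A U T"
  shows "ICE_interval A U T \<longleftrightarrow> T \<subseteq> coker_class U"
proof -
  have U: "torsion_class A U" and T: "torsion_class A T" and UT: "U \<subseteq> T"
    using assms by (auto simp: tors_interval_iff)
  note UO = torsion_class_Obj[OF U] and TO = torsion_class_Obj[OF T]
  have "T \<subseteq> coker_class U" if ICE: "ICE_interval A U T"
  proof
    fix X assume X: "X \<in> T"
    have "Cod A c \<in> right_perp A U"
      if Y: "Y \<in> right_perp A U" and f: "f \<in> Hom A X Y" and c: "is_cokernel A f c" for Y f c
    proof (rule ccontr)
      assume nF: "Cod A c \<notin> right_perp A U"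
      obtain I E V e i p where *: "e \<in> Hom A X I" "epic A e" "i \<in> Hom A I E" "p \<in> Hom A E V"
        "short_exact A i p" "I \<in> heart A U T" "E \<in> heart A U T" "V \<in> U" "\<not> zero_object A V"
        using torsion_in_cokernelE[OF U T UT X Y f c nF] .
      have "cokernel_closed A (heart A U T)"
        using ICE by (simp add: ICE_interval_def ICE_closed_def)
      then have "V \<in> heart A U T"
        using short_exactD(2)[OF *(5)] HomD[OF *(3)] HomD[OF *(4)] *(6,7)
        unfolding cokernel_closed_def by metis
      then show False using torsion_torsionfree_zero *(8,9) by (auto simp: heart_def)
    qed
    then show "X \<in> coker_class U" unfolding coker_class_def using X TO by blast
  qed
  moreover have "ICE_interval A U T" if "T \<subseteq> coker_class U"
    unfolding ICE_interval_def ICE_closed_def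
    using assms heart_subcategory[OF U T] heart_extension_closed[OF U T] heart_image_closed[OF U T]
      heart_cokernel_closed[OF T that] by blast
  ultimately show ?thesis by blast
qed

text \<open>
  A test arrow \<open>g : K \<rightarrow> Z\<close> on the kernel \<open>K\<close> of \<open>X \<rightarrow> Y\<close> has the same cokernel as its pushout
  \<open>X \<rightarrow> P\<close>, and \<open>P\<close> is torsionfree as an extension of the image of \<open>X \<rightarrow> Y\<close> by \<open>Z\<close>.
\<close>

lemma coker_class_kernel:
  assumes U: "torsion_class A U" and X: "X \<in> coker_class U" and Y: "Y \<in> right_perp A U"
    and f: "f \<in> Hom A X Y" and k: "k \<in> Hom A K X" "is_kernel A f k"
  shows "K \<in> coker_class U"
proof (rule coker_classI[OF torsion_class_Obj[OF U] Hom_objs(1)[OF k(1)]])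
  fix Z g assume Z: "Z \<in> right_perp A U" and g: "g \<in> Hom A K Z"
  note UO = torsion_class_Obj[OF U]
  obtain I e m where em: "e \<in> Hom A X I" "epic A e" "m \<in> Hom A I Y" "monic A m" "f = m \<cdot> e"
    using image_factorization[OF f] .
  have ke: "is_kernel A e k" using k(2) kernel_of_monic_Comp[OF em(1,3,4)] em(5) by simp
  have se: "short_exact A k e"
    unfolding short_exact_def using ke epic_cokernel_of_kernel[OF em(2,1) ke] by simp
  obtain P x z q where x: "x \<in> Hom A X P" and z: "z \<in> Hom A Z P" and q: "q \<in> Hom A P I"
    and sq: "x \<cdot> k = z \<cdot> g" and ex: "short_exact A z q"
    and univ: "\<forall>W. \<forall>a\<in>Hom A X W. \<forall>b\<in>Hom A Z W. a \<cdot> k = b \<cdot> g \<longrightarrow>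
       (\<exists>w\<in>Hom A P W. w \<cdot> x = a \<and> w \<cdot> z = b)"
    and joint: "\<forall>W. \<forall>w\<in>Hom A P W. w \<cdot> x = Zero A X W \<and> w \<cdot> z = Zero A Z W \<longrightarrow> w = Zero A P W"
    using pushout_short_exactE[OF se k(1) em(1) g] by metis
  have P: "P \<in> right_perp A U"
    by (rule right_perp_extension[OF UO ex z q Z right_perp_subobject[OF UO em(3,4) Y]])
  obtain C c where c: "c \<in> Hom A P C" "is_cokernel A x c" using cokernelE[OF x] .
  note cz = Comp_in_Hom[OF z c(1)]
  have cx: "c \<cdot> x = Zero A X C" by (rule cokernel_zero[OF c(2) x c(1)])
  have "is_cokernel A g (c \<cdot> z)"
  proof (rule is_cokernelI[OF g cz])
    have "(c \<cdot> z) \<cdot> g = (c \<cdot> x) \<cdot> k"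
      using Comp_assoc[OF g z c(1)] Comp_assoc[OF k(1) x c(1)] sq by simp
    then show "(c \<cdot> z) \<cdot> g = Zero A K C"
      using cx Comp_Zero_left[OF k(1) Hom_objs(2)[OF c(1)]] by simp
    show "epic A (c \<cdot> z)"
    proof (rule epicI_zero[OF cz])
      fix W w assume w: "w \<in> Hom A C W" and 0: "w \<cdot> (c \<cdot> z) = Zero A Z W"
      have "(w \<cdot> c) \<cdot> z = Zero A Z W" using 0 Comp_assoc[OF z c(1) w] by simp
      moreover have "(w \<cdot> c) \<cdot> x = Zero A X W" by (rule Comp_zero_mid(1)[OF x c(1) w cx])
      ultimately have "w \<cdot> c = Zero A P W" using joint Comp_in_Hom[OF c(1) w] by blast
      then show "w = Zero A C W" by (rule epic_cancel_zero[OF cokernel_epic[OF c(2)] c(1) w])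
    qed
    fix W h assume h: "h \<in> Hom A Z W" and 0: "h \<cdot> g = Zero A K W"
    note W = Hom_objs(2)[OF h]
    have "Zero A X W \<cdot> k = h \<cdot> g" using 0 Comp_Zero_left[OF k(1) W] by simp
    then obtain w where w: "w \<in> Hom A P W" "w \<cdot> x = Zero A X W" "w \<cdot> z = h"
      using univ h Zero_in_Hom[OF Hom_objs(1)[OF f] W] by blast
    obtain t where t: "t \<in> Hom A C W" "t \<cdot> c = w" using cokernel_desc[OF c(2) x c(1) w(1,2)] .
    then have "t \<cdot> (c \<cdot> z) = h" using Comp_assoc[OF z c(1) t(1)] w(3) by simp
    then show "\<exists>u\<in>Hom A C W. u \<cdot> (c \<cdot> z) = h" using t(1) by blast
  qed
  moreover have "C \<in> right_perp A U" using coker_classD[OF X P x c(2)] HomD[OF c(1)] by simp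
  ultimately show "\<exists>c. is_cokernel A g c \<and> Cod A c \<in> right_perp A U" using HomD[OF cz] by auto
qed

lemma wide_interval_coker_class:
  assumes U: "torsion_class A U"
  shows "wide_interval A U (coker_class U)"
proof -
  note UO = torsion_class_Obj[OF U] and P = torsion_class_coker_class[OF torsion_class_Obj[OF U]]
  have "kernel_closed A (heart A U (coker_class U))"
    unfolding kernel_closed_def
  proof (intro allI impI)
    fix f k assume *: "Dom A f \<in> heart A U (coker_class U) \<and> Cod A f \<in> heart A U (coker_class U)
      \<and> is_kernel A f k"
    then have f: "f \<in> Hom A (Dom A f) (Cod A f)" by (auto simp: is_kernel_def Hom_def)
    have k: "is_kernel A f k" using * by simp
    note kH = kernel_Hom[OF k f]
    show "Dom A k \<in> heart A U (coker_class U)"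
      unfolding heart_def
      using coker_class_kernel[OF U _ _ f kH k] right_perp_subobject[OF UO kH kernel_monic[OF k]] *
      by (simp add: heart_def)
  qed
  then show ?thesis
    unfolding wide_interval_def wide_def tors_interval_iff
    using U P torsion_subset_coker_class[OF U] heart_subcategory[OF U P] heart_extension_closed[OF U P]
      heart_cokernel_closed[OF P] by blast
qed

lemma wide_interval_subset_coker_class:
  assumes "wide_interval A U T"
  shows "T \<subseteq> coker_class U"
proof -
  have int: "tors_interval A U T" using assms by (simp add: wide_interval_def)
  then have "image_closed A (heart A U T)" using heart_image_closed by (simp add: tors_interval_iff)
  then have "ICE_interval A U T"
    using assms unfolding wide_interval_def wide_def ICE_interval_def ICE_closed_def by blast
  then show ?thesis using ICE_interval_iff_subset_coker_class[OF int] by simp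
qed

end


section \<open>Covers of a torsion class\<close>

context abelian_length_category
begin

text \<open>
  Divide out the images of torsion objects one after the other. Each step makes the object shorter
  and, by closure under extensions, stays outside \<open>U\<close>.
\<close>

lemma torsionfree_quotientE:
  assumes U: "torsion_class A U" and X: "X \<in> Obj A" "X \<notin> U"
  obtains Q e where "e \<in> Hom A X Q" "epic A e" "Q \<in> right_perp A U" "\<not> zero_object A Q"
proof -
  have "\<exists>Q e. e \<in> Hom A X Q \<and> epic A e \<and> Q \<in> right_perp A U \<and> \<not> zero_object A Q"
    using X
  proof (induction "len X" arbitrary: X rule: less_induct)
    case less
    show ?case
    proof (cases "X \<in> right_perp A U")
      case True
      then show ?thesis
        using Ide_in_Hom Ide_epic less.prems torsion_class_zero[OF U] by blast
    next
      case False
      then obtain V h where V: "V \<in> U" and h: "h \<in> Hom A V X" "h \<noteq> Zero A V X"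
        using right_perpI[OF torsion_class_Obj[OF U] less.prems(1)] by blast
      obtain I e m where em: "e \<in> Hom A V I" "epic A e" "m \<in> Hom A I X" "monic A m" "h = m \<cdot> e"
        using image_factorization[OF h(1)] .
      obtain Q c where c: "c \<in> Hom A X Q" "is_cokernel A m c" using cokernelE[OF em(3)] .
      have se: "short_exact A m c"
        unfolding short_exact_def using c(2) monic_kernel_of_cokernel[OF em(4,3) c(2)] by simp
      have "\<not> iso_arrow A c"
      proof
        assume "iso_arrow A c"
        then have "m = Zero A I X"
          using monic_cancel_zero[OF iso_arrow_monic c(1) em(3) cokernel_zero[OF c(2) em(3) c(1)]] by simp
        then show False using h(2) em(5) Comp_Zero_left[OF em(1) less.prems(1)] by simp
      qed
      then have "len Q < len X" by (rule len_quotient_less[OF cokernel_epic[OF c(2)] c(1)])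
      moreover have "Q \<notin> U"
        using torsion_class_extension[OF U se em(3) c(1) torsion_class_quotient[OF U em(1,2) V]]
          less.prems(2) by blast
      ultimately obtain Q' d where "d \<in> Hom A Q Q'" "epic A d" "Q' \<in> right_perp A U" "\<not> zero_object A Q'"
        using less.hyps Hom_objs(2)[OF c(1)] by blast
      then show ?thesis using Comp_in_Hom[OF c(1)] epic_Comp[OF c(1) _ cokernel_epic[OF c(2)]] by blast
    qed
  qed
  then show ?thesis using that by blast
qed

text \<open>
  This is how simple objects relative to a class are found: a nonzero object of least length has no
  room for proper nonzero subobjects in the class.
\<close>

lemma minimal_lengthE:
  assumes "X \<in> \<X>" "\<not> zero_object A X"
  obtains S where "S \<in> \<X>" "\<not> zero_object A S"
    "\<And>N m. \<lbrakk>m \<in> Hom A N S; monic A m; N \<in> \<X>; \<not> zero_object A N\<rbrakk> \<Longrightarrow> iso_arrow A m"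
proof -
  obtain S where S: "S \<in> \<X> \<and> \<not> zero_object A S" "\<And>N. N \<in> \<X> \<and> \<not> zero_object A N \<Longrightarrow> len S \<le> len N"
    using ex_has_least_nat[of "\<lambda>S. S \<in> \<X> \<and> \<not> zero_object A S" X len] assms by blast
  show ?thesis
    by (rule that[of S]) (use S len_subobject_less in \<open>auto simp: not_le[symmetric]\<close>)
qed

text \<open>
  It suffices to find one object \<open>S\<close> of \<open>U' \<inter> coker_class U\<close> outside \<open>U\<close>, because this intersection is
  a torsion class between \<open>U\<close> and \<open>U'\<close>. Take \<open>S\<close> nonzero of least length in the heart. A cokernel of an
  arrow from \<open>S\<close> that is not torsionfree would yield an exact sequence \<open>I \<rightarrow> E \<rightarrow> V\<close> with \<open>I\<close> a
  quotient of \<open>S\<close>, with \<open>E\<close> torsionfree and with \<open>V\<close> torsion and nonzero. There is a nonzero arrow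
  \<open>E \<rightarrow> S\<close>; it cannot vanish on \<open>I\<close>, as it would then factor through \<open>V\<close>. By minimality of \<open>S\<close> the
  composite \<open>S \<rightarrow> I \<rightarrow> E \<rightarrow> S\<close> is invertible, so the sequence splits and \<open>V\<close> embeds into \<open>E\<close>.
\<close>

lemma cover_subset_coker_class:
  assumes U: "torsion_class A U" and U': "torsion_class A U'" and less: "U \<subset> U'"
    and cover: "\<And>R. \<lbrakk>torsion_class A R; U \<subseteq> R; R \<subseteq> U'\<rbrakk> \<Longrightarrow> R = U \<or> R = U'"
  shows "U' \<subseteq> coker_class U"
proof -
  note UO = torsion_class_Obj[OF U] and UO' = torsion_class_Obj[OF U']
  obtain X where X: "X \<in> U'" "X \<notin> U" using less by blast
  then obtain Q eQ where Q: "eQ \<in> Hom A X Q" "epic A eQ" "Q \<in> right_perp A U" "\<not> zero_object A Q"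
    using torsionfree_quotientE[OF U] UO' by blast
  have "Q \<in> heart A U U'"
    unfolding heart_def using Q(3) torsion_class_quotient[OF U' Q(1,2) X(1)] by simp
  then obtain S where S: "S \<in> heart A U U'" "\<not> zero_object A S"
    and simple: "\<And>N m. \<lbrakk>m \<in> Hom A N S; monic A m; N \<in> heart A U U'; \<not> zero_object A N\<rbrakk> \<Longrightarrow> iso_arrow A m"
    using minimal_lengthE[OF _ Q(4)] by metis
  have SU': "S \<in> U'" and SF: "S \<in> right_perp A U" using S(1) by (auto simp: heart_def)
  have SO: "S \<in> Obj A" using SU' UO' by blast
  have SU: "S \<notin> U" using torsion_torsionfree_zero[OF _ SF] S(2) by blast
  \<comment> \<open>a torsion class between \<open>U\<close> and \<open>U'\<close> that misses \<open>S\<close> can only be \<open>U\<close>\<close>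
  have left: "U' \<inter> left_perp {S} = U"
  proof -
    have "U \<subseteq> left_perp {S}" using right_perpD[OF SF] UO by (auto simp: left_perp_def)
    moreover have "S \<notin> left_perp {S}"
      using Ide_in_Hom[OF SO] S(2) SO by (auto simp: left_perp_def zero_object_iff)
    ultimately show ?thesis
      using cover[OF torsion_class_Int[OF U' torsion_class_left_perp[of "{S}"]]] less SU' by blast
  qed
  have "Cod A c \<in> right_perp A U"
    if Y: "Y \<in> right_perp A U" and f: "f \<in> Hom A S Y" and c: "is_cokernel A f c" for Y f c
  proof (rule ccontr)
    assume nF: "Cod A c \<notin> right_perp A U"
    obtain I E V e i p where e: "e \<in> Hom A S I" "epic A e" and i: "i \<in> Hom A I E"
      and p: "p \<in> Hom A E V" and se: "short_exact A i p" and I: "I \<in> heart A U U'"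
      and E: "E \<in> heart A U U'" and V: "V \<in> U" "\<not> zero_object A V"
      using torsion_in_cokernelE[OF U U' psubset_imp_subset[OF less] SU' Y f c nF] .
    note ex = short_exactD[OF se] and EF = E[unfolded heart_def, THEN IntD2]
    note EO = Hom_objs(1)[OF p] and IO = Hom_objs(1)[OF i]
    have "E \<notin> U"
      using torsion_torsionfree_zero[OF _ EF] zero_object_epic[OF ex(4) p] V(2) by blast
    then obtain g where g: "g \<in> Hom A E S" "g \<noteq> Zero A E S"
      using left E EO by (auto simp: heart_def left_perp_def)
    note gi = Comp_in_Hom[OF i g(1)]
    have gi0: "g \<cdot> i \<noteq> Zero A I S"
    proof
      assume "g \<cdot> i = Zero A I S"
      then obtain t where t: "t \<in> Hom A V S" "t \<cdot> p = g" using cokernel_desc[OF ex(2) i p g(1)] by blast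
      then show False using right_perpD[OF SF V(1) t(1)] g(2) Comp_Zero_left[OF p SO] by simp
    qed
    obtain J j1 j2 where j: "j1 \<in> Hom A I J" "epic A j1" "j2 \<in> Hom A J S" "monic A j2" "g \<cdot> i = j2 \<cdot> j1"
      using image_factorization[OF gi] .
    have "\<not> zero_object A J"
      using gi0 j(5) zero_object_Hom(1)[OF _ j(3)] Comp_Zero_left[OF j(1) SO] by auto
    moreover have "J \<in> heart A U U'"
      using torsion_class_quotient[OF U' j(1,2)] right_perp_subobject[OF UO j(3,4) SF] I
      by (simp add: heart_def)
    ultimately have "iso_arrow A j2" using simple[OF j(3,4)] by blast
    then have "epic A (g \<cdot> i)" using epic_Comp[OF j(1,3,2) iso_arrow_epic] j(5) by simp
    note ep = epic_Comp[OF e(1) gi e(2) this] and gie = Comp_in_Hom[OF e(1) gi]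
    \<comment> \<open>a surjective endomorphism of \<open>S\<close> is invertible, so \<open>i\<close> splits\<close>
    have "iso_arrow A ((g \<cdot> i) \<cdot> e)" using len_quotient_less[OF ep gie] by blast
    then obtain w where w: "w \<in> Hom A S S" "w \<cdot> ((g \<cdot> i) \<cdot> e) = Ide A S"
      using iso_arrowE[OF _ gie] by blast
    note ew = Comp_in_Hom[OF w(1) e(1)]
    define r where "r = (e \<cdot> w) \<cdot> g"
    have r: "r \<in> Hom A E I" unfolding r_def by (rule Comp_in_Hom[OF g(1) ew])
    have "(r \<cdot> i) \<cdot> e = ((e \<cdot> w) \<cdot> (g \<cdot> i)) \<cdot> e" unfolding r_def using Comp_assoc[OF i g(1) ew] by simp
    also have "\<dots> = e \<cdot> (w \<cdot> ((g \<cdot> i) \<cdot> e))"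
      using Comp_assoc[OF e(1) gi ew] Comp_assoc[OF gie w(1) e(1)] by simp
    also have "\<dots> = Ide A I \<cdot> e" using w(2) Comp_Ide_left[OF e(1)] Comp_Ide_right[OF e(1)] by simp
    finally have ri: "r \<cdot> i = Ide A I"
      using epic_cancel[OF e(2,1) Comp_in_Hom[OF i r] Ide_in_Hom[OF IO]] by simp
    \<comment> \<open>hence \<open>V\<close> is a torsion summand of the torsionfree object \<open>E\<close>\<close>
    note ir = Comp_in_Hom[OF r i]
    obtain d where d: "d \<in> Hom A E E" "Ide A E = d \<oplus>\<^sub>h i \<cdot> r" using differenceE[OF Ide_in_Hom[OF EO] ir] .
    have "i = d \<cdot> i \<oplus>\<^sub>h i"
      using Comp_Plus_left[OF i d(1) ir] d(2) Comp_Ide_left[OF i] Comp_assoc[OF i r i] ri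
        Comp_Ide_right[OF i] by simp
    then have "d \<cdot> i = Zero A I E"
      using Plus_cancel[OF Comp_in_Hom[OF i d(1)] Zero_in_Hom[OF IO EO] i] Plus_Zero[OF i] by simp
    then obtain t where t: "t \<in> Hom A V E" "t \<cdot> p = d" using cokernel_desc[OF ex(2) i p d(1)] by blast
    have "d = Zero A E E" using t(2) right_perpD[OF EF V(1) t(1)] Comp_Zero_left[OF p EO] by simp
    then have "Ide A E = i \<cdot> r" using d(2) Plus_Zero[OF ir] by simp
    then have "p = Zero A E V"
      using Comp_Ide_right[OF p] Comp_zero_mid(2)[OF r i p kernel_zero[OF ex(1) p i]] by simp
    then show False using epic_Zero_object ex(4) V(2) Hom_objs[OF p] by simp
  qed
  then have "S \<in> coker_class U" unfolding coker_class_def using SO by blast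
  then have "U' \<inter> coker_class U = U'"
    using cover[OF torsion_class_Int[OF U' torsion_class_coker_class[OF UO]]]
      torsion_subset_coker_class[OF U] less SU' SU by blast
  then show ?thesis by blast
qed

text \<open>
  A torsion class that bounds the join of \<open>U\<close> and \<open>S\<close> from above: in the heart of \<open>U\<close> and
  \<open>coker_class U\<close>, with \<open>S\<close> simple, the defining property holds for all objects with a finite
  filtration by copies of \<open>S\<close>, but unlike such filtrations it is immediately inherited by quotients.
\<close>

definition tested_by :: "'o set \<Rightarrow> 'o \<Rightarrow> 'o set" where
  "tested_by U S = {X \<in> coker_class U. \<forall>Y e. e \<in> Hom A X Y \<and> epic A e \<and> Y \<in> right_perp A U \<and>
     \<not> zero_object A Y \<longrightarrow> (\<exists>g\<in>Hom A Y S. g \<noteq> Zero A Y S)}"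

lemma torsion_class_tested_by:
  assumes U: "torsion_class A U"
  shows "torsion_class A (tested_by U S)"
proof (rule torsion_classI)
  note P = torsion_class_coker_class[OF torsion_class_Obj[OF U]]
  show "tested_by U S \<subseteq> Obj A" using torsion_class_Obj[OF P] by (auto simp: tested_by_def)
  show "X \<in> tested_by U S" if "zero_object A X" for X
    using torsion_class_zero[OF P that] zero_object_epic[OF _ _ that] by (auto simp: tested_by_def)
  show "Y \<in> tested_by U S" if e: "e \<in> Hom A X Y" "epic A e" and X: "X \<in> tested_by U S" for X Y e
    using torsion_class_quotient[OF P e] X Comp_in_Hom[OF e(1)] epic_Comp[OF e(1) _ e(2)]
    unfolding tested_by_def by blast
  fix X' X X'' a b
  assume se: "short_exact A a b" and a: "a \<in> Hom A X' X" and b: "b \<in> Hom A X X''"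
    and X': "X' \<in> tested_by U S" and X'': "X'' \<in> tested_by U S"
  note ex = short_exactD[OF se]
  have "\<exists>g\<in>Hom A Y S. g \<noteq> Zero A Y S"
    if e: "e \<in> Hom A X Y" "epic A e" and Y: "Y \<in> right_perp A U" "\<not> zero_object A Y" for Y e
  proof -
    note ea = Comp_in_Hom[OF a e(1)]
    obtain Q q where q: "q \<in> Hom A Y Q" "is_cokernel A (e \<cdot> a) q" using cokernelE[OF ea] .
    note eq = cokernel_epic[OF q(2)]
    show ?thesis
    proof (cases "zero_object A Q")
      case True
      then have "epic A (e \<cdot> a)" using cokernel_zero_epic[OF ea q(2)] HomD[OF q(1)] by simp
      then show ?thesis using X' ea Y unfolding tested_by_def by blast
    next
      case False
      have Q: "Q \<in> right_perp A U"
        using coker_classD[OF _ Y(1) ea q(2)] X' HomD[OF q(1)] by (simp add: tested_by_def)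
      have "(q \<cdot> e) \<cdot> a = Zero A X' Q"
        using cokernel_zero[OF q(2) ea q(1)] Comp_assoc[OF a e(1) q(1)] by simp
      then obtain t where t: "t \<in> Hom A X'' Q" "t \<cdot> b = q \<cdot> e"
        using cokernel_desc[OF ex(2) a b Comp_in_Hom[OF e(1) q(1)]] by blast
      have "epic A (t \<cdot> b)" using epic_Comp[OF e(1) q(1) e(2) eq] t(2) by simp
      then have "epic A t" by (rule epic_of_Comp[OF b t(1)])
      then obtain g where g: "g \<in> Hom A Q S" "g \<noteq> Zero A Q S"
        using X'' t(1) Q False unfolding tested_by_def by blast
      then have "g \<cdot> q \<noteq> Zero A Y S" using epic_cancel_zero[OF eq q(1) g(1)] by blast
      then show ?thesis using Comp_in_Hom[OF q(1) g(1)] by blast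
    qed
  qed
  moreover have "X \<in> coker_class U"
    using torsion_class_extension[OF P se a b] X' X'' by (simp add: tested_by_def)
  ultimately show "X \<in> tested_by U S" unfolding tested_by_def by blast
qed

text \<open>
  Suppose that \<open>R\<close> does not contain \<open>coker_class U\<close>, and let \<open>S\<close> be nonzero of least length in the part of
  \<open>coker_class U\<close> that is torsionfree for \<open>R\<close>. Let \<open>J\<close> be the join of \<open>U\<close> and \<open>S\<close>. It is contained in
  \<open>tested_by U S\<close>, so a torsion class strictly above \<open>U\<close> and inside \<open>J\<close> contains a torsionfree object
  with a nonzero arrow to \<open>S\<close>. By minimality this arrow is onto, so \<open>S\<close> lies in that torsion class,
  which is then \<open>J\<close>. Thus \<open>J\<close> covers \<open>U\<close>, and \<open>J \<subseteq> R\<close> would make \<open>S\<close> both torsion and torsionfree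
  for \<open>R\<close>.
\<close>

lemma coker_class_subset:
  assumes U: "torsion_class A U" and R: "torsion_class A R" "U \<subseteq> R"
    and covers: "\<And>J. \<lbrakk>torsion_class A J; U \<subset> J;
      \<And>R'. \<lbrakk>torsion_class A R'; U \<subseteq> R'; R' \<subseteq> J\<rbrakk> \<Longrightarrow> R' = U \<or> R' = J\<rbrakk> \<Longrightarrow> J \<subseteq> R"
  shows "coker_class U \<subseteq> R"
proof (rule ccontr)
  note UO = torsion_class_Obj[OF U] and RO = torsion_class_Obj[OF R(1)]
  note P = torsion_class_coker_class[OF UO]
  assume "\<not> coker_class U \<subseteq> R"
  then obtain X where X: "X \<in> coker_class U" "X \<notin> R" by blast
  then obtain Q eQ where Q: "eQ \<in> Hom A X Q" "epic A eQ" "Q \<in> right_perp A R" "\<not> zero_object A Q"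
    using torsionfree_quotientE[OF R(1)] torsion_class_Obj[OF P] by blast
  have "Q \<in> heart A R (coker_class U)"
    unfolding heart_def using Q(3) torsion_class_quotient[OF P Q(1,2) X(1)] by simp
  then obtain S where S: "S \<in> heart A R (coker_class U)" "\<not> zero_object A S"
    and simple: "\<And>N m. \<lbrakk>m \<in> Hom A N S; monic A m; N \<in> heart A R (coker_class U); \<not> zero_object A N\<rbrakk>
      \<Longrightarrow> iso_arrow A m"
    using minimal_lengthE[OF _ Q(4)] by metis
  have SP: "S \<in> coker_class U" and SR: "S \<in> right_perp A R" using S(1) by (auto simp: heart_def)
  have SF: "S \<in> right_perp A U" using SR right_perp_antimono[OF R(2)] by blast
  have SU: "S \<notin> U" using torsion_torsionfree_zero[OF _ SF] S(2) by blast
  have simpleP: "iso_arrow A m" if "m \<in> Hom A N S" "monic A m" "N \<in> coker_class U" "\<not> zero_object A N" for N m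
    using simple[OF that(1,2) _ that(4)] that(3) right_perp_subobject[OF RO that(1,2) SR]
    by (simp add: heart_def)
  define J where "J = \<Inter>{T. torsion_class A T \<and> U \<subseteq> T \<and> S \<in> T}"
  have J: "torsion_class A J"
    unfolding J_def
    by (rule torsion_class_Inter) (use P torsion_subset_coker_class[OF U] SP in blast)+
  have J_least: "J \<subseteq> T" if "torsion_class A T" "U \<subseteq> T" "S \<in> T" for T
    unfolding J_def using that by blast
  have UJ: "U \<subset> J" "S \<in> J" unfolding J_def using SU by blast+
  have "U \<subseteq> tested_by U S"
  proof
    fix V assume V: "V \<in> U"
    have "zero_object A Y" if "e \<in> Hom A V Y" "epic A e" "Y \<in> right_perp A U" for Y e
      using torsion_torsionfree_zero[OF torsion_class_quotient[OF U that(1,2) V] that(3)] .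
    then show "V \<in> tested_by U S"
      using V torsion_subset_coker_class[OF U] unfolding tested_by_def by blast
  qed
  moreover have "S \<in> tested_by U S"
  proof -
    have "\<exists>g\<in>Hom A Y S. g \<noteq> Zero A Y S"
      if e: "e \<in> Hom A S Y" "epic A e" and Y: "Y \<in> right_perp A U" "\<not> zero_object A Y" for Y e
    proof -
      obtain K k where k: "k \<in> Hom A K S" "is_kernel A e k" using kernelE[OF e(1)] .
      have K: "K \<in> coker_class U" by (rule coker_class_kernel[OF U SP Y(1) e(1) k])
      have "\<not> iso_arrow A k"
      proof
        assume "iso_arrow A k"
        then have "e = Zero A S Y"
          using epic_cancel_zero[OF iso_arrow_epic k(1) e(1) kernel_zero[OF k(2) e(1) k(1)]] by simp
        then show False using epic_Zero_object e(2) Y(2) Hom_objs[OF e(1)] by simp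
      qed
      then have "zero_object A K" using simpleP[OF k(1) kernel_monic[OF k(2)] K] by blast
      then have "monic A e" using kernel_zero_monic[OF e(1) k(2)] HomD[OF k(1)] by simp
      then obtain g where g: "g \<in> Hom A Y S" "e \<cdot> g = Ide A Y"
        using iso_arrowE[OF monic_epic_iso[OF _ e(2,1)] e(1)] by blast
      have "g \<noteq> Zero A Y S"
        using g Y(2) Comp_Zero_right[OF e(1)] Hom_objs(2)[OF e(1)] by (auto simp: zero_object_iff)
      then show ?thesis using g(1) by blast
    qed
    then show ?thesis using SP unfolding tested_by_def by blast
  qed
  ultimately have JS: "J \<subseteq> tested_by U S" using J_least[OF torsion_class_tested_by[OF U]] by blast
  have "R' = U \<or> R' = J" if R': "torsion_class A R'" "U \<subseteq> R'" "R' \<subseteq> J" for R'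
  proof (rule disjCI)
    assume "R' \<noteq> J"
    then have SR': "S \<notin> R'" using J_least[OF R'(1,2)] R'(3) by blast
    have "M \<in> U" if M: "M \<in> R'" for M
    proof (rule ccontr)
      assume "M \<notin> U"
      then obtain N e where N: "e \<in> Hom A M N" "epic A e" "N \<in> right_perp A U" "\<not> zero_object A N"
        using torsionfree_quotientE[OF U] torsion_class_Obj[OF R'(1)] M by blast
      have NR': "N \<in> R'" by (rule torsion_class_quotient[OF R'(1) N(1,2) M])
      have "M \<in> tested_by U S" using M R'(3) JS by blast
      then obtain g where g: "g \<in> Hom A N S" "g \<noteq> Zero A N S"
        using N unfolding tested_by_def by blast
      obtain I d m where im: "d \<in> Hom A N I" "epic A d" "m \<in> Hom A I S" "monic A m" "g = m \<cdot> d"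
        using image_factorization[OF g(1)] .
      have IR': "I \<in> R'" by (rule torsion_class_quotient[OF R'(1) im(1,2) NR'])
      have "\<not> zero_object A I"
        using g(2) im(5) zero_object_Hom(1)[OF _ im(3)] Comp_Zero_left[OF im(1) Hom_objs(2)[OF im(3)]]
        by auto
      moreover have "I \<in> coker_class U" using IR' R'(3) JS by (auto simp: tested_by_def)
      ultimately have "iso_arrow A m" using simpleP[OF im(3,4)] by blast
      then have "S \<in> R'" using torsion_class_quotient[OF R'(1) im(3) iso_arrow_epic IR'] by blast
      then show False using SR' by blast
    qed
    then show "R' = U" using R'(2) by blast
  qed
  then have "J \<subseteq> R" using covers[OF J UJ(1)] by blast
  then show False using torsion_torsionfree_zero[OF _ SR] UJ(2) S(2) by blast
qed

end


section \<open>Joins in the lattice of torsion classes\<close>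

context abelian_category
begin

lemma tors_Sup:
  assumes "\<S> \<subseteq> Collect (torsion_class A)"
  shows "\<Squnion>\<^bsub>tors A\<^esub> \<S> = \<Inter>{T. torsion_class A T \<and> (\<forall>X\<in>\<S>. X \<subseteq> T)}"
proof -
  let ?B = "\<Inter>{T. torsion_class A T \<and> (\<forall>X\<in>\<S>. X \<subseteq> T)}"
  have Upper: "Upper (tors A) \<S> = {T. torsion_class A T \<and> (\<forall>X\<in>\<S>. X \<subseteq> T)}"
    using assms by (auto simp: Upper_def tors_def)
  have "torsion_class A ?B"
    by (rule torsion_class_Inter) (use assms torsion_class_all torsion_class_Obj in auto)
  then have B: "least (tors A) ?B (Upper (tors A) \<S>)"
    unfolding least_def Upper by (auto simp: tors_def)
  have "x = ?B" if "least (tors A) x (Upper (tors A) \<S>)" for x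
  proof (rule subset_antisym)
    have le: "Y \<subseteq> Z" if "least (tors A) Y W" "Z \<in> W" for Y Z W
      using that by (simp add: least_def tors_def)
    have mem: "Y \<in> W" if "least (tors A) Y W" for Y W using that by (simp add: least_def)
    show "x \<subseteq> ?B" by (rule le[OF that mem[OF B]])
    show "?B \<subseteq> x" by (rule le[OF B mem[OF that]])
  qed
  then show ?thesis unfolding sup_def using B by (intro some_equality)
qed

lemma Hasse_arrow_tors_iff:
  "Hasse_arrow (tors A) U' U \<longleftrightarrow> torsion_class A U' \<and> torsion_class A U \<and> U \<subset> U' \<and>
    (\<forall>R. torsion_class A R \<and> U \<subseteq> R \<and> R \<subseteq> U' \<longrightarrow> R = U \<or> R = U')"
  unfolding Hasse_arrow_def lless_def by (auto simp: tors_def)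

lemma tors_plus_eq:
  assumes "torsion_class A U"
  shows "tors_plus A U =
    \<Inter>{T. torsion_class A T \<and> U \<subseteq> T \<and> (\<forall>U'. Hasse_arrow (tors A) U' U \<longrightarrow> U' \<subseteq> T)}"
proof -
  define \<C> where "\<C> = {U' \<in> carrier (tors A). Hasse_arrow (tors A) U' U}"
  define J where "J = \<Squnion>\<^bsub>tors A\<^esub> \<C>"
  have J: "J = \<Inter>{T. torsion_class A T \<and> (\<forall>X\<in>\<C>. X \<subseteq> T)}"
    unfolding J_def by (rule tors_Sup) (auto simp: \<C>_def tors_def)
  have "torsion_class A J"
    unfolding J by (rule torsion_class_Inter) (use torsion_class_all torsion_class_Obj in \<open>auto simp: \<C>_def tors_def\<close>)
  moreover have "J \<subseteq> T \<longleftrightarrow> (\<forall>X\<in>\<C>. X \<subseteq> T)" if "torsion_class A T" for T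
    using that unfolding J by blast
  ultimately have "tors_plus A U = \<Inter>{T. torsion_class A T \<and> U \<subseteq> T \<and> (\<forall>X\<in>\<C>. X \<subseteq> T)}"
    unfolding tors_plus_def join_def J_def[symmetric] \<C>_def[symmetric]
    using tors_Sup[of "{U, J}"] assms by (simp cong: conj_cong)
  then show ?thesis unfolding \<C>_def by (simp add: Hasse_arrow_def)
qed

end

lemma (in abelian_length_category) tors_plus_eq_coker_class:
  assumes U: "torsion_class A U"
  shows "tors_plus A U = coker_class U"
proof
  have "U' \<subseteq> coker_class U" if "Hasse_arrow (tors A) U' U" for U'
    by (rule cover_subset_coker_class[OF U]) (use that in \<open>simp_all add: Hasse_arrow_tors_iff\<close>)
  then show "tors_plus A U \<subseteq> coker_class U"
    unfolding tors_plus_eq[OF U]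
    using torsion_class_coker_class[OF torsion_class_Obj[OF U]] torsion_subset_coker_class[OF U] by blast
  have "coker_class U \<subseteq> T"
    if "torsion_class A T" "U \<subseteq> T" "\<And>U'. Hasse_arrow (tors A) U' U \<Longrightarrow> U' \<subseteq> T" for T
  proof (rule coker_class_subset[OF U that(1,2)])
    fix J
    assume "torsion_class A J" "U \<subset> J"
      and "\<And>R. \<lbrakk>torsion_class A R; U \<subseteq> R; R \<subseteq> J\<rbrakk> \<Longrightarrow> R = U \<or> R = J"
    then have "Hasse_arrow (tors A) J U" using U by (simp add: Hasse_arrow_tors_iff)
    then show "J \<subseteq> T" by (rule that(3))
  qed
  then show "coker_class U \<subseteq> tors_plus A U" unfolding tors_plus_eq[OF U] by blast
qed


section \<open>Realizing an ICE-closed subcategory as a heart\<close>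

text \<open>
  The images in objects of \<open>C\<close> are given as quotients \<open>I\<close> of \<open>X\<close> that embed into an object of \<open>C\<close>.
\<close>

definition (in preadditive_category) image_class :: "'o set \<Rightarrow> 'o set" where
  "image_class C = {X \<in> Obj A. \<forall>I M e m. e \<in> Hom A X I \<and> epic A e \<and> m \<in> Hom A I M \<and> monic A m \<and>
     M \<in> C \<longrightarrow> I \<in> C}"

context abelian_category
begin

text \<open>
  Closure under extensions is where \<open>C\<close> has to be closed under cokernels: for \<open>X' \<rightarrow> X \<rightarrow> X''\<close> and an
  arrow \<open>X \<rightarrow> M\<close>, the image of \<open>X\<close> in \<open>M\<close> is an extension of the image of \<open>X''\<close> in \<open>M / I'\<close> by the
  image \<open>I'\<close> of \<open>X'\<close> in \<open>M\<close>.
\<close>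

lemma torsion_class_image_class:
  assumes C: "subcategory A C" "extension_closed A C" "cokernel_closed A C"
  shows "torsion_class A (image_class C)"
proof (rule torsion_classI)
  show "image_class C \<subseteq> Obj A" by (auto simp: image_class_def)
  show "X \<in> image_class C" if "zero_object A X" for X
    using that zero_object_epic[OF _ _ that] subcategory_zero[OF C(1)]
    by (auto simp: image_class_def zero_object_iff)
  show "Y \<in> image_class C" if d: "d \<in> Hom A X Y" "epic A d" and X: "X \<in> image_class C" for X Y d
    using X Hom_objs(2)[OF d(1)] Comp_in_Hom[OF d(1)] epic_Comp[OF d(1) _ d(2)]
    unfolding image_class_def by blast
  fix X' X X'' a b
  assume se: "short_exact A a b" and a: "a \<in> Hom A X' X" and b: "b \<in> Hom A X X''"
    and X': "X' \<in> image_class C" and X'': "X'' \<in> image_class C"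
  note ex = short_exactD[OF se]
  have "I \<in> C"
    if e: "e \<in> Hom A X I" "epic A e" and m: "m \<in> Hom A I M" "monic A m" and M: "M \<in> C" for I M e m
  proof -
    note ea = Comp_in_Hom[OF a e(1)]
    \<comment> \<open>the part \<open>I'\<close> of the image that comes from \<open>X'\<close>\<close>
    obtain I' e' i where i: "e' \<in> Hom A X' I'" "epic A e'" "i \<in> Hom A I' I" "monic A i" "e \<cdot> a = i \<cdot> e'"
      using image_factorization[OF ea] .
    note mi = Comp_in_Hom[OF i(3) m(1)] and mmi = monic_Comp[OF i(3) m(1) i(4) m(2)]
    have I': "I' \<in> C" using X' i(1,2) mi mmi M unfolding image_class_def by blast
    obtain Q q where q: "q \<in> Hom A M Q" "is_cokernel A (m \<cdot> i) q" using cokernelE[OF mi] .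
    note kq = monic_kernel_of_cokernel[OF mmi mi q(2)]
    have Q: "Q \<in> C"
      using C(3) q(2) I' M HomD[OF mi] HomD[OF q(1)] unfolding cokernel_closed_def by metis
    \<comment> \<open>the rest of the image is the image of \<open>X'' \<rightarrow> M / I'\<close>\<close>
    note qm = Comp_in_Hom[OF m(1) q(1)]
    obtain R r n where r: "r \<in> Hom A I R" "epic A r" "n \<in> Hom A R Q" "monic A n" "q \<cdot> m = n \<cdot> r"
      using image_factorization[OF qm] .
    have ri: "r \<cdot> i = Zero A I' R"
    proof (rule monic_cancel_zero[OF r(4,3) Comp_in_Hom[OF i(3) r(1)]])
      have "n \<cdot> (r \<cdot> i) = q \<cdot> (m \<cdot> i)"
        using Comp_assoc[OF i(3) r(1,3)] Comp_assoc[OF i(3) m(1) q(1)] r(5) by simp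
      then show "n \<cdot> (r \<cdot> i) = Zero A I' Q" using kernel_zero[OF kq q(1) mi] by simp
    qed
    have kr: "is_kernel A r i"
    proof (rule is_kernelI[OF r(1) i(3) ri i(4)])
      fix W w assume w: "w \<in> Hom A W I" and 0: "r \<cdot> w = Zero A W R"
      have "q \<cdot> (m \<cdot> w) = n \<cdot> (r \<cdot> w)"
        using Comp_assoc[OF w r(1,3)] Comp_assoc[OF w m(1) q(1)] r(5) by simp
      then have "q \<cdot> (m \<cdot> w) = Zero A W Q" using 0 Comp_Zero_right[OF r(3) Hom_objs(1)[OF w]] by simp
      then obtain u where u: "u \<in> Hom A W I'" "(m \<cdot> i) \<cdot> u = m \<cdot> w"
        using kernel_lift[OF kq q(1) mi Comp_in_Hom[OF w m(1)]] by blast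
      then have "i \<cdot> u = w"
        using monic_cancel[OF m(2,1) Comp_in_Hom[OF u(1) i(3)] w] Comp_assoc[OF u(1) i(3) m(1)] by simp
      then show "\<exists>u\<in>Hom A W I'. i \<cdot> u = w" using u(1) by blast
    qed
    have sr: "short_exact A i r"
      unfolding short_exact_def using kr epic_cokernel_of_kernel[OF r(2,1) kr] by simp
    note re = Comp_in_Hom[OF e(1) r(1)]
    have "(r \<cdot> e) \<cdot> a = (r \<cdot> i) \<cdot> e'"
      using Comp_assoc[OF a e(1) r(1)] Comp_assoc[OF i(1,3) r(1)] i(5) by simp
    then have "(r \<cdot> e) \<cdot> a = Zero A X' R"
      using ri Comp_Zero_left[OF i(1) Hom_objs(2)[OF r(1)]] by simp
    then obtain t where t: "t \<in> Hom A X'' R" "t \<cdot> b = r \<cdot> e" using cokernel_desc[OF ex(2) a b re] by blast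
    have "epic A t" using epic_of_Comp[OF b t(1)] epic_Comp[OF e(1) r(1) e(2) r(2)] t(2) by simp
    then have "R \<in> C" using X'' t(1) r(3,4) Q unfolding image_class_def by blast
    then show ?thesis using extension_closedD[OF C(2) sr i(3) r(1) I'] by blast
  qed
  then show "X \<in> image_class C" unfolding image_class_def using Hom_objs(2)[OF a] by blast
qed

lemma left_perp_subset_image_class:
  assumes "subcategory A C"
  shows "left_perp C \<subseteq> image_class C"
proof
  fix X assume X: "X \<in> left_perp C"
  have "I \<in> C"
    if e: "e \<in> Hom A X I" "epic A e" and m: "m \<in> Hom A I M" "monic A m" and M: "M \<in> C" for I M e m
  proof -
    have "m \<cdot> e = Zero A X M" using X Comp_in_Hom[OF e(1) m(1)] M by (simp add: left_perp_def)
    then have "e = Zero A X I" by (rule monic_cancel_zero[OF m(2,1) e(1)])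
    then show ?thesis
      using epic_Zero_object e(2) Hom_objs[OF e(1)] subcategory_zero[OF assms] by simp
  qed
  then show "X \<in> image_class C" using X unfolding image_class_def left_perp_def by blast
qed

end

text \<open>
  Given an object \<open>X\<close> of the heart, choose \<open>e : X \<rightarrow> I\<close> onto an object of \<open>C\<close> with
  shortest possible kernel \<open>K\<close>. If \<open>K\<close> is nonzero, there is a nonzero arrow \<open>g : K \<rightarrow> N\<close> with \<open>N\<close> in
  \<open>C\<close>, because \<open>X\<close> is right orthogonal to \<open>left_perp C\<close> and so \<open>K\<close> is not in \<open>left_perp C\<close>. Pushing
  out along \<open>g\<close> gives an arrow from \<open>X\<close> to an extension of \<open>I\<close> by \<open>N\<close>, again in \<open>C\<close>, whose kernel
  is \<open>ker g\<close>, and that is shorter than \<open>K\<close>. Hence \<open>K = 0\<close> and \<open>X\<close> is isomorphic to \<open>I\<close>.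
\<close>

lemma (in abelian_length_category) heart_image_class:
  assumes ICE: "ICE_closed A C"
  shows "heart A (left_perp C) (image_class C) = C"
proof
  have C: "subcategory A C" "extension_closed A C" "cokernel_closed A C" "image_closed A C"
    using ICE by (auto simp: ICE_closed_def)
  note UO = torsion_class_Obj[OF torsion_class_left_perp[of C]]
  have CO: "C \<subseteq> Obj A" using C(1) by (simp add: subcategory_def)
  show "C \<subseteq> heart A (left_perp C) (image_class C)"
  proof
    fix X assume X: "X \<in> C"
    have "I \<in> C"
      if e: "e \<in> Hom A X I" "epic A e" and m: "m \<in> Hom A I M" "monic A m" and M: "M \<in> C" for I M e m
      using C(4) epic_monic_is_image[OF e m] HomD[OF Comp_in_Hom[OF e(1) m(1)]] HomD[OF m(1)] X M
      unfolding image_closed_def by metis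
    then have "X \<in> image_class C" unfolding image_class_def using X CO by blast
    moreover have "X \<in> right_perp A (left_perp C)"
      by (rule right_perpI[OF UO]) (use X CO in \<open>auto simp: left_perp_def\<close>)
    ultimately show "X \<in> heart A (left_perp C) (image_class C)" by (simp add: heart_def)
  qed
  show "heart A (left_perp C) (image_class C) \<subseteq> C"
  proof
    fix X assume "X \<in> heart A (left_perp C) (image_class C)"
    then have X: "X \<in> image_class C" and XF: "X \<in> right_perp A (left_perp C)" by (auto simp: heart_def)
    define \<K> where "\<K> = {K. \<exists>M f k. M \<in> C \<and> f \<in> Hom A X M \<and> k \<in> Hom A K X \<and> is_kernel A f k}"
    obtain Z where Z: "Z \<in> C" "zero_object A Z" using C(1) by (auto simp: subcategory_def)
    note z = Zero_in_Hom[OF right_perp_Obj[OF XF] subsetD[OF CO Z(1)]]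
    obtain K0 k0 where "k0 \<in> Hom A K0 X" "is_kernel A (Zero A X Z) k0" using kernelE[OF z] .
    then have "K0 \<in> \<K>" unfolding \<K>_def using Z(1) z by blast
    then obtain K where K: "K \<in> \<K>" and minimal: "\<And>K'. K' \<in> \<K> \<Longrightarrow> len K \<le> len K'"
      using ex_has_least_nat[of "\<lambda>K. K \<in> \<K>" K0 len] by blast
    obtain M f k where M: "M \<in> C" and f: "f \<in> Hom A X M" and k: "k \<in> Hom A K X" "is_kernel A f k"
      using K unfolding \<K>_def by blast
    note mk = kernel_monic[OF k(2)]
    obtain I e m where em: "e \<in> Hom A X I" "epic A e" "m \<in> Hom A I M" "monic A m" "f = m \<cdot> e"
      using image_factorization[OF f] .
    have I: "I \<in> C" using X em(1-4) M unfolding image_class_def by blast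
    have ke: "is_kernel A e k"
      using k(2) kernel_of_monic_Comp[OF em(1,3,4)] em(5) by simp
    have "zero_object A K"
    proof (rule ccontr)
      assume nz: "\<not> zero_object A K"
      have "K \<in> right_perp A (left_perp C)" by (rule right_perp_subobject[OF UO k(1) mk XF])
      then have "K \<notin> left_perp C" using torsion_torsionfree_zero nz by blast
      then obtain N g where N: "N \<in> C" and g: "g \<in> Hom A K N" "g \<noteq> Zero A K N"
        using Hom_objs(1)[OF k(1)] by (auto simp: left_perp_def)
      have se: "short_exact A k e"
        unfolding short_exact_def using ke epic_cokernel_of_kernel[OF em(2,1) ke] by simp
      obtain P x y q where x: "x \<in> Hom A X P" and y: "y \<in> Hom A N P" and q: "q \<in> Hom A P I"
        and ex: "short_exact A y q"
        and kerx: "\<forall>W. \<forall>w\<in>Hom A W X. x \<cdot> w = Zero A W P \<longrightarrow>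
          (\<exists>u\<in>Hom A W K. w = k \<cdot> u \<and> g \<cdot> u = Zero A W N)"
        using pushout_short_exactE[OF se k(1) em(1) g(1)] by metis
      have P: "P \<in> C" by (rule extension_closedD[OF C(2) ex y q N I])
      obtain K' k' where k': "k' \<in> Hom A K' X" "is_kernel A x k'" using kernelE[OF x] .
      have K': "K' \<in> \<K>" unfolding \<K>_def using P x k' by blast
      obtain u where u: "u \<in> Hom A K' K" "k' = k \<cdot> u" "g \<cdot> u = Zero A K' N"
        using kerx k'(1) kernel_zero[OF k'(2) x k'(1)] by blast
      have "monic A u" using monic_of_Comp[OF u(1) k(1)] u(2) kernel_monic[OF k'(2)] by simp
      moreover have "\<not> iso_arrow A u"
        using epic_cancel_zero[OF iso_arrow_epic u(1) g(1) u(3)] g(2) by blast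
      ultimately have "len K' < len K" using len_subobject_less[OF _ u(1)] by blast
      then show False using minimal[OF K'] by simp
    qed
    then have "monic A e" using kernel_zero_monic[OF em(1) ke] HomD[OF k(1)] by simp
    then have "isomorphic A I X"
      using isomorphicI[OF monic_epic_iso[OF _ em(2,1)] em(1)] isomorphic_sym by blast
    then show "X \<in> C" using C(1) I unfolding subcategory_def by blast
  qed
qed

theorem theorem2:
  fixes A :: "('o, 'm) preadditive_category"
  assumes "abelian_length_category A"
  shows "(\<forall>C. ICE_closed A C \<longrightarrow> (\<exists>U T. tors_interval A U T \<and> heart A U T = C)) \<and>
    (\<forall>U T. tors_interval A U T \<longrightarrow>
      (ICE_interval A U T \<longleftrightarrow>
        (\<exists>T'\<in>carrier (tors A). U \<subseteq> T \<and> T \<subseteq> T' \<and> wide_interval A U T')) \<and>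
      (ICE_interval A U T \<longleftrightarrow> T \<subseteq> tors_plus A U))"
proof -
  interpret abelian_length_category A by (rule assms)
  show ?thesis
  proof (intro conjI allI impI)
    fix C assume ICE: "ICE_closed A C"
    then have "torsion_class A (image_class C)" "left_perp C \<subseteq> image_class C"
      using torsion_class_image_class left_perp_subset_image_class by (auto simp: ICE_closed_def)
    then have "tors_interval A (left_perp C) (image_class C)"
      using torsion_class_left_perp by (simp add: tors_interval_iff)
    then show "\<exists>U T. tors_interval A U T \<and> heart A U T = C" using heart_image_class[OF ICE] by blast
  next
    fix U T assume int: "tors_interval A U T"
    then have U: "torsion_class A U" and UT: "U \<subseteq> T" by (auto simp: tors_interval_iff)
    note ICE = ICE_interval_iff_subset_coker_class[OF int]
    note wide = wide_interval_coker_class[OF U]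
    have "coker_class U \<in> carrier (tors A)"
      using wide by (simp add: wide_interval_def tors_interval_def)
    then show "ICE_interval A U T \<longleftrightarrow>
        (\<exists>T'\<in>carrier (tors A). U \<subseteq> T \<and> T \<subseteq> T' \<and> wide_interval A U T')"
      using ICE UT wide wide_interval_subset_coker_class by blast
    show "ICE_interval A U T \<longleftrightarrow> T \<subseteq> tors_plus A U"
      using ICE tors_plus_eq_coker_class[OF U] by simp
  qed
qed

end
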